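(* Let $(G_0, G'_0)$ be an irreducible reductive dual pair of real Lie groups in the real symplectic group $Sp(W_0)$, with complexified Lie algebras $\mathfrak{g}$ and $\mathfrak{g}'$. Suppose that $\rho$ and $\rho'$ are irreducible admissible representations of the metaplectic covers $\widetilde{G_0}$ and $\widetilde{G'_0}$ of $G_0$ and $G'_0$ that correspond to each other under the real Howe duality correspondence. Denote by $I\subset U(\mathfrak{g})$ and $I'\subset U(\mathfrak{g}')$ the annihilators of $\rho$ and $\rho'$ in the universal enveloping algebras of $\mathfrak{g}$ and $\mathfrak{g}'$. Then $\theta(I')\subseteq I$, where $\theta$ is the transfer map.
   Context: Weyl algebra. For a symplectic vector space $W$, the Weyl algebra $\mathcal{W}$ is the associative algebra generated by the vector space $W$ modulo the relations $w_1w_2-w_2w_1=\langle w_1,w_2\rangle$. The span $\mathcal{W}^2\subset\mathcal{W}$ of the elements $\frac12(w_1w_2+w_2w_1)$ ($w_1,w_2\in W$) is closed under commutators and is identified with $\mathfrak{sp}(W)$ by its adjoint action on $W\subset\mathcal{W}$. Reductive dual pairs. A reductive dual pair of Lie algebras in $\mathfrak{sp}(W)$ is a pair of Lie subalgebras $(\mathfrak{g},\mathfrak{g}')$ that are full mutual centralizers in $\mathfrak{sp}(W)$ and each of which acts completely reducibly on $W$. A reductive dual pair of groups in $Sp(W_0)$ is defined analogously: reductive subgroups that are full mutual centralizers; the pair is irreducible if the joint action on the symplectic space is symplectically irreducible (no nontrivial decomposition as an orthogonal direct sum of invariant symplectic subspaces). Here $W_0$ is a real symplectic vector space and $W=W_0\otimes_{\mathbb{R}}\mathbb{C}$;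 the complexified Lie algebras $\mathfrak{g},\mathfrak{g}'$ of $G_0,G_0'$ form a reductive dual pair in $\mathfrak{sp}(W)$. Transfer. Let $L:U(\mathfrak{g}')\to\mathcal{W}$ and $R:U(\mathfrak{g})\to\mathcal{W}$ be the canonical homomorphisms, i.e. those extending the inclusions of $\mathfrak{g}'$ and $\mathfrak{g}$ into $\mathfrak{sp}(W)\simeq\mathcal{W}^2\subset\mathcal{W}$. For a subspace $I'$ of $U(\mathfrak{g}')$, its transfer is $\theta(I')=R^{-1}(L(I')\cdot\mathcal{W})\subseteq U(\mathfrak{g})$, the preimage under $R$ of the right ideal of $\mathcal{W}$ generated by $L(I')$. Howe duality. Let $\widetilde{Sp}$ be the metaplectic two-fold cover of $Sp(W_0)$ and $\widetilde{G_0},\widetilde{G'_0}$ the preimages of $G_0,G_0'$ in it. Let $\omega$ be the oscillator representation of $\widetilde{Sp}$. A maximal compact subgroup of $Sp(W_0)$ is chosen so that the associated Cartan decomposition of $Sp(W_0)$ induces Cartan decompositions of $G_0$ and $G'_0$, and all representations are replaced by their Harish-Chandra modules of $K$-finite vectors; the complexified Weyl algebra $\mathcal{W}$ acts on $\omega$. Irreducible admissible representations $\rho$ of $\widetilde{G_0}$ and $\rho'$ of $\widetilde{G'_0}$ correspond to each other under the Howe duality if there exists a subspace $\omega_0\subset\omega$ invariant under $\widetilde{G_0}\cdot\widetilde{G'_0}$ (in the sense of Harish-Chandra modules) such that $\omega/\omega_0$ is isomorphic to $\rho\otimes\rho'$. *)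

theory Defs
  imports "HOL-Analysis.Analysis" "HOL-Algebra.QuotRing" "HOL-Algebra.Module" "HOL-Library.Poly_Mapping"
begin

section \<open>Complex vector spaces as records\<close>

text \<open>
  Complex vector spaces are HOL-Algebra modules over the ring of complex numbers; an associative
  algebra uses all fields of the record, a mere vector space leaves \<open>mult\<close> and \<open>one\<close> unspecified,
  and a Lie algebra stores its bracket in \<open>mult\<close>.
\<close>

definition complex_field :: "complex ring" where
  "complex_field = \<lparr>carrier = UNIV, mult = (*), one = 1, zero = 0, add = (+)\<rparr>"

abbreviation complex_space :: "(complex, 'v, 'z) module_scheme \<Rightarrow> bool" where
  "complex_space V \<equiv> Module.module complex_field V"

abbreviation complex_subspace :: "'v set \<Rightarrow> (complex, 'v, 'z) module_scheme \<Rightarrow> bool" where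
  "complex_subspace N V \<equiv> submodule N complex_field V"

definition lin_span :: "(complex, 'v, 'z) module_scheme \<Rightarrow> 'v set \<Rightarrow> 'v set" where
  "lin_span V S = \<Inter>{N. complex_subspace N V \<and> S \<subseteq> N}"

definition linear_map ::
    "(complex, 'v, 'z) module_scheme \<Rightarrow> (complex, 'u, 'y) module_scheme \<Rightarrow> ('v \<Rightarrow> 'u) \<Rightarrow> bool" where
  "linear_map V U f \<longleftrightarrow> f \<in> carrier V \<rightarrow> carrier U \<and>
     (\<forall>x\<in>carrier V. \<forall>y\<in>carrier V. f (x \<oplus>\<^bsub>V\<^esub> y) = f x \<oplus>\<^bsub>U\<^esub> f y) \<and>
     (\<forall>c. \<forall>x\<in>carrier V. f (c \<odot>\<^bsub>V\<^esub> x) = c \<odot>\<^bsub>U\<^esub> f x)"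

definition linear_functional :: "(complex, 'v, 'z) module_scheme \<Rightarrow> ('v \<Rightarrow> complex) \<Rightarrow> bool" where
  "linear_functional V l \<longleftrightarrow>
     (\<forall>x\<in>carrier V. \<forall>y\<in>carrier V. l (x \<oplus>\<^bsub>V\<^esub> y) = l x + l y) \<and>
     (\<forall>c. \<forall>x\<in>carrier V. l (c \<odot>\<^bsub>V\<^esub> x) = c * l x)"

text \<open>\<open>E\<close> is contained in a finite-dimensional subspace of \<open>V\<close>.\<close>

definition finite_dim :: "(complex, 'v, 'z) module_scheme \<Rightarrow> 'v set \<Rightarrow> bool" where
  "finite_dim V E \<longleftrightarrow> (\<exists>B. finite B \<and> B \<subseteq> carrier V \<and> E \<subseteq> lin_span V B)"

text \<open>
  The quotient by a subspace \<open>N\<close>, with the elements being cosets; if \<open>N\<close> is a two-sided ideal of an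
  algebra this is the quotient algebra.  A linear map \<open>f\<close> with \<open>f ` N \<subseteq> N\<close> induces
  \<open>x + N \<mapsto> f x + N\<close> on the quotient.
\<close>

definition quot_map ::
    "(complex, 'v, 'z) module_scheme \<Rightarrow> 'v set \<Rightarrow> ('v \<Rightarrow> 'v) \<Rightarrow> 'v set \<Rightarrow> 'v set" where
  "quot_map V N f X = (\<Union>x\<in>X. N +>\<^bsub>V\<^esub> f x)"

definition quot_space ::
    "(complex, 'v, 'z) module_scheme \<Rightarrow> 'v set \<Rightarrow> (complex, 'v set) module" where
  "quot_space V N = ring.extend (V Quot N)
     (module.fields (\<lambda>c. quot_map V N (\<lambda>x. c \<odot>\<^bsub>V\<^esub> x)))"

section \<open>Tensor products\<close>

definition free_space :: "'x set \<Rightarrow> (complex, 'x \<Rightarrow>\<^sub>0 complex) module" where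
  "free_space S = \<lparr>carrier = {f. Poly_Mapping.keys f \<subseteq> S}, mult = undefined, one = undefined,
     zero = 0, add = (+), smult = (\<lambda>c. Poly_Mapping.map ((*) c))\<rparr>"

abbreviation basis_vec :: "'x \<Rightarrow> 'x \<Rightarrow>\<^sub>0 complex" where
  "basis_vec x \<equiv> Poly_Mapping.single x 1"

definition tensor_relations ::
    "(complex, 'v, 'z) module_scheme \<Rightarrow> (complex, 'u, 'y) module_scheme
      \<Rightarrow> ('v \<times> 'u \<Rightarrow>\<^sub>0 complex) set" where
  "tensor_relations V U =
     {basis_vec (x \<oplus>\<^bsub>V\<^esub> y, u) - basis_vec (x, u) - basis_vec (y, u) | x y u.
        x \<in> carrier V \<and> y \<in> carrier V \<and> u \<in> carrier U} \<union>
     {basis_vec (x, u \<oplus>\<^bsub>U\<^esub> w) - basis_vec (x, u) - basis_vec (x, w) | x u w.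
        x \<in> carrier V \<and> u \<in> carrier U \<and> w \<in> carrier U} \<union>
     {basis_vec (c \<odot>\<^bsub>V\<^esub> x, u) - Poly_Mapping.single (x, u) c | c x u.
        x \<in> carrier V \<and> u \<in> carrier U} \<union>
     {basis_vec (x, c \<odot>\<^bsub>U\<^esub> u) - Poly_Mapping.single (x, u) c | c x u.
        x \<in> carrier V \<and> u \<in> carrier U}"

definition tensor_null ::
    "(complex, 'v, 'z) module_scheme \<Rightarrow> (complex, 'u, 'y) module_scheme
      \<Rightarrow> ('v \<times> 'u \<Rightarrow>\<^sub>0 complex) set" where
  "tensor_null V U =
     lin_span (free_space (carrier V \<times> carrier U)) (tensor_relations V U)"

definition tensor ::
    "(complex, 'v, 'z) module_scheme \<Rightarrow> (complex, 'u, 'y) module_scheme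
      \<Rightarrow> (complex, ('v \<times> 'u \<Rightarrow>\<^sub>0 complex) set) module" where
  "tensor V U = quot_space (free_space (carrier V \<times> carrier U)) (tensor_null V U)"

text \<open>\<open>tensor_map V U f g\<close> is the operator \<open>f \<otimes> g\<close> on \<open>V \<otimes> U\<close>.\<close>

definition tensor_map ::
    "(complex, 'v, 'z) module_scheme \<Rightarrow> (complex, 'u, 'y) module_scheme
      \<Rightarrow> ('v \<Rightarrow> 'v) \<Rightarrow> ('u \<Rightarrow> 'u)
      \<Rightarrow> ('v \<times> 'u \<Rightarrow>\<^sub>0 complex) set \<Rightarrow> ('v \<times> 'u \<Rightarrow>\<^sub>0 complex) set" where
  "tensor_map V U f g =
     quot_map (free_space (carrier V \<times> carrier U)) (tensor_null V U)
       (\<lambda>t. \<Sum>k\<in>Poly_Mapping.keys t.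
          Poly_Mapping.single (map_prod f g k) (Poly_Mapping.lookup t k))"

section \<open>Algebras given by generators and relations\<close>

text \<open>
  Words under concatenation form a monoid; since convolution of finitely supported functions is set
  up additively in the library, concatenation is written as addition.  The type
  \<open>'x word \<Rightarrow>\<^sub>0 complex\<close> is then the free associative unital algebra on \<open>'x\<close>.
\<close>

datatype 'x word = Word (letters: "'x list")

instantiation word :: (type) monoid_add
begin
definition "0 = Word []"
definition "v + w = Word (letters v @ letters w)"
instance
  by standard (auto simp: zero_word_def plus_word_def)
end

definition free_algebra :: "'x set \<Rightarrow> (complex, 'x word \<Rightarrow>\<^sub>0 complex) module" where
  "free_algebra X = \<lparr>carrier = {t. \<forall>w\<in>Poly_Mapping.keys t. set (letters w) \<subseteq> X},
     mult = (*), one = 1, zero = 0, add = (+), smult = (\<lambda>c. Poly_Mapping.map ((*) c))\<rparr>"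

abbreviation gen :: "'x \<Rightarrow> 'x word \<Rightarrow>\<^sub>0 complex" where
  "gen x \<equiv> Poly_Mapping.single (Word [x]) 1"

abbreviation const_elem :: "complex \<Rightarrow> 'x word \<Rightarrow>\<^sub>0 complex" where
  "const_elem c \<equiv> Poly_Mapping.single 0 c"

definition presented ::
    "'x set \<Rightarrow> ('x word \<Rightarrow>\<^sub>0 complex) set \<Rightarrow> (complex, ('x word \<Rightarrow>\<^sub>0 complex) set) module" where
  "presented X Rel = quot_space (free_algebra X) (Idl\<^bsub>free_algebra X\<^esub> Rel)"

definition presented_gen ::
    "'x set \<Rightarrow> ('x word \<Rightarrow>\<^sub>0 complex) set \<Rightarrow> 'x \<Rightarrow> ('x word \<Rightarrow>\<^sub>0 complex) set" where
  "presented_gen X Rel x = (Idl\<^bsub>free_algebra X\<^esub> Rel) +>\<^bsub>free_algebra X\<^esub> gen x"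

text \<open>The relations making the generators depend linearly on the vectors of \<open>V\<close>.\<close>

definition linear_relations ::
    "(complex, 'v, 'z) module_scheme \<Rightarrow> ('v word \<Rightarrow>\<^sub>0 complex) set" where
  "linear_relations V =
     {gen (x \<oplus>\<^bsub>V\<^esub> y) - gen x - gen y | x y. x \<in> carrier V \<and> y \<in> carrier V} \<union>
     {gen (c \<odot>\<^bsub>V\<^esub> x) - const_elem c * gen x | c x. x \<in> carrier V}"

text \<open>The action on \<open>V\<close> of an element of the free algebra whose letters act by \<open>act\<close>.\<close>

definition free_act ::
    "(complex, 'v, 'z) module_scheme \<Rightarrow> ('x \<Rightarrow> 'v \<Rightarrow> 'v) \<Rightarrow> ('x word \<Rightarrow>\<^sub>0 complex) \<Rightarrow> 'v \<Rightarrow> 'v" where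
  "free_act V act t v =
     (\<Oplus>\<^bsub>V\<^esub> w\<in>Poly_Mapping.keys t. Poly_Mapping.lookup t w \<odot>\<^bsub>V\<^esub> foldr act (letters w) v)"

definition generated_left_ideal :: "('a, 'z) ring_scheme \<Rightarrow> 'a set \<Rightarrow> 'a set" where
  "generated_left_ideal A S = \<Inter>{I. subgroup I (add_monoid A) \<and>
     (\<forall>a\<in>carrier A. \<forall>x\<in>I. a \<otimes>\<^bsub>A\<^esub> x \<in> I) \<and> S \<subseteq> I}"

definition generated_right_ideal :: "('a, 'z) ring_scheme \<Rightarrow> 'a set \<Rightarrow> 'a set" where
  "generated_right_ideal A S = \<Inter>{I. subgroup I (add_monoid A) \<and>
     (\<forall>a\<in>carrier A. \<forall>x\<in>I. x \<otimes>\<^bsub>A\<^esub> a \<in> I) \<and> S \<subseteq> I}"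

section \<open>The real symplectic group\<close>

definition symplectic_form :: "('w::euclidean_space \<Rightarrow> 'w \<Rightarrow> real) \<Rightarrow> bool" where
  "symplectic_form s \<longleftrightarrow> bilinear s \<and> (\<forall>x. s x x = 0) \<and> (\<forall>x. (\<forall>y. s x y = 0) \<longrightarrow> x = 0)"

text \<open>Preserving a nondegenerate form makes an endomorphism of a finite-dimensional space invertible.\<close>

definition Sp :: "('w::euclidean_space \<Rightarrow> 'w \<Rightarrow> real) \<Rightarrow> ('w \<Rightarrow>\<^sub>L 'w) monoid" where
  "Sp s = \<lparr>carrier = {g. \<forall>x y. s (blinfun_apply g x) (blinfun_apply g y) = s x y},
     mult = (o\<^sub>L), one = id_blinfun\<rparr>"

definition endo_exp :: "('w::euclidean_space \<Rightarrow>\<^sub>L 'w) \<Rightarrow> ('w \<Rightarrow>\<^sub>L 'w)" where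
  "endo_exp X = suminf (\<lambda>n. (1 / fact n) *\<^sub>R (((o\<^sub>L) X ^^ n) id_blinfun))"

definition real_lie :: "('w::euclidean_space \<Rightarrow>\<^sub>L 'w) set \<Rightarrow> ('w \<Rightarrow>\<^sub>L 'w) set" where
  "real_lie G = {X. \<forall>t::real. endo_exp (t *\<^sub>R X) \<in> G}"

definition Sp_centralizer ::
    "('w::euclidean_space \<Rightarrow> 'w \<Rightarrow> real) \<Rightarrow> ('w \<Rightarrow>\<^sub>L 'w) set \<Rightarrow> ('w \<Rightarrow>\<^sub>L 'w) set" where
  "Sp_centralizer s A = {g \<in> carrier (Sp s). \<forall>h\<in>A. g o\<^sub>L h = h o\<^sub>L g}"

definition invariant_subspace :: "('w::euclidean_space \<Rightarrow>\<^sub>L 'w) set \<Rightarrow> 'w set \<Rightarrow> bool" where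
  "invariant_subspace A U \<longleftrightarrow> subspace U \<and> (\<forall>g\<in>A. blinfun_apply g ` U \<subseteq> U)"

definition acts_completely_reducibly :: "('w::euclidean_space \<Rightarrow>\<^sub>L 'w) set \<Rightarrow> bool" where
  "acts_completely_reducibly A \<longleftrightarrow>
     (\<forall>U. invariant_subspace A U \<longrightarrow>
        (\<exists>U'. invariant_subspace A U' \<and> U \<inter> U' = {0} \<and> {x + y | x y. x \<in> U \<and> y \<in> U'} = UNIV))"

definition reductive_dual_pair ::
    "('w::euclidean_space \<Rightarrow> 'w \<Rightarrow> real) \<Rightarrow> ('w \<Rightarrow>\<^sub>L 'w) set \<Rightarrow> ('w \<Rightarrow>\<^sub>L 'w) set \<Rightarrow> bool" where
  "reductive_dual_pair s G G' \<longleftrightarrow>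
     subgroup G (Sp s) \<and> subgroup G' (Sp s) \<and>
     acts_completely_reducibly G \<and> acts_completely_reducibly G' \<and>
     G' = Sp_centralizer s G \<and> G = Sp_centralizer s G'"

definition symplectic_subspace ::
    "('w::euclidean_space \<Rightarrow> 'w \<Rightarrow> real) \<Rightarrow> 'w set \<Rightarrow> bool" where
  "symplectic_subspace s U \<longleftrightarrow>
     subspace U \<and> (\<forall>x\<in>U. (\<forall>y\<in>U. s x y = 0) \<longrightarrow> x = 0)"

definition symplectically_irreducible ::
    "('w::euclidean_space \<Rightarrow> 'w \<Rightarrow> real) \<Rightarrow> ('w \<Rightarrow>\<^sub>L 'w) set \<Rightarrow> bool" where
  "symplectically_irreducible s A \<longleftrightarrow>
     \<not> (\<exists>U U'. invariant_subspace A U \<and> invariant_subspace A U' \<and>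
          symplectic_subspace s U \<and> symplectic_subspace s U' \<and>
          U \<noteq> {0} \<and> U' \<noteq> {0} \<and> (\<forall>x\<in>U. \<forall>y\<in>U'. s x y = 0) \<and>
          U \<inter> U' = {0} \<and> {x + y | x y. x \<in> U \<and> y \<in> U'} = UNIV)"

definition irreducible_reductive_dual_pair ::
    "('w::euclidean_space \<Rightarrow> 'w \<Rightarrow> real) \<Rightarrow> ('w \<Rightarrow>\<^sub>L 'w) set \<Rightarrow> ('w \<Rightarrow>\<^sub>L 'w) set \<Rightarrow> bool" where
  "irreducible_reductive_dual_pair s G G' \<longleftrightarrow>
     reductive_dual_pair s G G' \<and> symplectically_irreducible s (G \<union> G')"

definition maximal_compact_subgroup ::
    "('w::euclidean_space \<Rightarrow> 'w \<Rightarrow> real) \<Rightarrow> ('w \<Rightarrow>\<^sub>L 'w) set \<Rightarrow> bool" where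
  "maximal_compact_subgroup s K \<longleftrightarrow> subgroup K (Sp s) \<and> compact K \<and>
     (\<forall>K'. subgroup K' (Sp s) \<and> compact K' \<and> K \<subseteq> K' \<longrightarrow> K' = K)"

text \<open>
  The summand \<open>p\<close> of the Cartan decomposition \<open>sp(W0) = k + p\<close> attached to \<open>K\<close>: the orthogonal
  complement of \<open>k\<close> under the trace form, which is a positive multiple of the Killing form.
\<close>

definition cartan_p ::
    "('w::euclidean_space \<Rightarrow> 'w \<Rightarrow> real) \<Rightarrow> ('w \<Rightarrow>\<^sub>L 'w) set \<Rightarrow> ('w \<Rightarrow>\<^sub>L 'w) set" where
  "cartan_p s K = {X \<in> real_lie (carrier (Sp s)).
     \<forall>Y\<in>real_lie K. (\<Sum>b\<in>Basis. blinfun_apply (X o\<^sub>L Y) b \<bullet> b) = 0}"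

text \<open>The decomposition \<open>Sp = K exp(p)\<close> restricts to \<open>G = (K \<inter> G) exp(p \<inter> Lie G)\<close>.\<close>

definition induces_cartan_decomposition ::
    "('w::euclidean_space \<Rightarrow> 'w \<Rightarrow> real) \<Rightarrow> ('w \<Rightarrow>\<^sub>L 'w) set \<Rightarrow> ('w \<Rightarrow>\<^sub>L 'w) set \<Rightarrow> bool" where
  "induces_cartan_decomposition s K G \<longleftrightarrow>
     G = {k o\<^sub>L endo_exp X | k X. k \<in> K \<inter> G \<and> X \<in> cartan_p s K \<inter> real_lie G}"

text \<open>
  \<open>Mp\<close>, whose carrier has the subspace topology, is a connected topological group and \<open>p\<close> a
  two-fold covering homomorphism onto \<open>Sp(W0)\<close>.  As the fundamental group of \<open>Sp(W0)\<close> is infinite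
  cyclic, this determines the pair up to isomorphism.
\<close>

definition metaplectic_cover ::
    "('w::euclidean_space \<Rightarrow> 'w \<Rightarrow> real) \<Rightarrow> 'm::topological_space monoid
      \<Rightarrow> ('m \<Rightarrow> 'w \<Rightarrow>\<^sub>L 'w) \<Rightarrow> bool" where
  "metaplectic_cover s Mp p \<longleftrightarrow>
     Group.group Mp \<and> connected (carrier Mp) \<and>
     continuous_on (carrier Mp \<times> carrier Mp) (\<lambda>(a, b). a \<otimes>\<^bsub>Mp\<^esub> b) \<and>
     continuous_on (carrier Mp) (m_inv Mp) \<and>
     p \<in> hom Mp (Sp s) \<and>
     covering_space (carrier Mp) p (carrier (Sp s)) \<and>
     (\<forall>g\<in>carrier (Sp s). card {m \<in> carrier Mp. p m = g} = 2)"

definition cover_preimage ::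
    "'m monoid \<Rightarrow> ('m \<Rightarrow> 'w::euclidean_space \<Rightarrow>\<^sub>L 'w) \<Rightarrow> ('w \<Rightarrow>\<^sub>L 'w) set \<Rightarrow> 'm set" where
  "cover_preimage Mp p A = {m \<in> carrier Mp. p m \<in> A}"

section \<open>Complexification\<close>

text \<open>\<open>W = W0 \<otimes> C\<close>, the pair \<open>(x, y)\<close> standing for \<open>x + i y\<close>.\<close>

type_synonym 'w cplx = "'w \<times> 'w"

definition cplx_scale :: "complex \<Rightarrow> 'w::real_vector cplx \<Rightarrow> 'w cplx" where
  "cplx_scale c v =
     (Re c *\<^sub>R fst v - Im c *\<^sub>R snd v, Re c *\<^sub>R snd v + Im c *\<^sub>R fst v)"

definition cplx_space :: "(complex, 'w::real_vector cplx) module" where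
  "cplx_space = \<lparr>carrier = UNIV, mult = undefined, one = undefined, zero = 0, add = (+),
     smult = cplx_scale\<rparr>"

definition cplx_form :: "('w::euclidean_space \<Rightarrow> 'w \<Rightarrow> real) \<Rightarrow> 'w cplx \<Rightarrow> 'w cplx \<Rightarrow> complex" where
  "cplx_form s v w = Complex (s (fst v) (fst w) - s (snd v) (snd w))
                             (s (fst v) (snd w) + s (snd v) (fst w))"

text \<open>The complex endomorphism \<open>X + i Y\<close> of \<open>W\<close>.\<close>

definition cplx_endo ::
    "('w::euclidean_space \<Rightarrow>\<^sub>L 'w) \<Rightarrow> ('w \<Rightarrow>\<^sub>L 'w) \<Rightarrow> 'w cplx \<Rightarrow> 'w cplx" where
  "cplx_endo X Y v = (blinfun_apply X (fst v) - blinfun_apply Y (snd v),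
                      blinfun_apply X (snd v) + blinfun_apply Y (fst v))"

definition complexified_lie :: "('w::euclidean_space \<Rightarrow>\<^sub>L 'w) set \<Rightarrow> ('w cplx \<Rightarrow> 'w cplx) set" where
  "complexified_lie G = {cplx_endo X Y | X Y. X \<in> real_lie G \<and> Y \<in> real_lie G}"

text \<open>A set of endomorphisms of \<open>W\<close> as a Lie algebra record; \<open>mult\<close> is the commutator.\<close>

definition endo_lie ::
    "('w::real_vector cplx \<Rightarrow> 'w cplx) set \<Rightarrow> (complex, 'w cplx \<Rightarrow> 'w cplx) module" where
  "endo_lie g = \<lparr>carrier = g, mult = (\<lambda>A B v. A (B v) - B (A v)), one = undefined,
     zero = (\<lambda>v. 0), add = (\<lambda>A B v. A v + B v), smult = (\<lambda>c A v. cplx_scale c (A v))\<rparr>"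

section \<open>Enveloping algebra, Weyl algebra and transfer\<close>

definition enveloping_relations ::
    "(complex, 'x, 'z) module_scheme \<Rightarrow> ('x word \<Rightarrow>\<^sub>0 complex) set" where
  "enveloping_relations L = linear_relations L \<union>
     {gen x * gen y - gen y * gen x - gen (x \<otimes>\<^bsub>L\<^esub> y) | x y. x \<in> carrier L \<and> y \<in> carrier L}"

definition enveloping ::
    "('w::real_vector cplx \<Rightarrow> 'w cplx) set
      \<Rightarrow> (complex, (('w cplx \<Rightarrow> 'w cplx) word \<Rightarrow>\<^sub>0 complex) set) module" where
  "enveloping g = presented g (enveloping_relations (endo_lie g))"

definition enveloping_gen ::
    "('w::real_vector cplx \<Rightarrow> 'w cplx) set \<Rightarrow> ('w cplx \<Rightarrow> 'w cplx)
      \<Rightarrow> (('w cplx \<Rightarrow> 'w cplx) word \<Rightarrow>\<^sub>0 complex) set" where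
  "enveloping_gen g = presented_gen g (enveloping_relations (endo_lie g))"

definition weyl_relations ::
    "('w::euclidean_space \<Rightarrow> 'w \<Rightarrow> real) \<Rightarrow> ('w cplx word \<Rightarrow>\<^sub>0 complex) set" where
  "weyl_relations s = linear_relations cplx_space \<union>
     {gen v * gen w - gen w * gen v - const_elem (cplx_form s v w) | v w. True}"

definition weyl ::
    "('w::euclidean_space \<Rightarrow> 'w \<Rightarrow> real) \<Rightarrow> (complex, ('w cplx word \<Rightarrow>\<^sub>0 complex) set) module" where
  "weyl s = presented UNIV (weyl_relations s)"

definition weyl_gen ::
    "('w::euclidean_space \<Rightarrow> 'w \<Rightarrow> real) \<Rightarrow> 'w cplx \<Rightarrow> ('w cplx word \<Rightarrow>\<^sub>0 complex) set" where
  "weyl_gen s = presented_gen UNIV (weyl_relations s)"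

definition weyl2 ::
    "('w::euclidean_space \<Rightarrow> 'w \<Rightarrow> real) \<Rightarrow> ('w cplx word \<Rightarrow>\<^sub>0 complex) set set" where
  "weyl2 s = lin_span (weyl s)
     {(1/2) \<odot>\<^bsub>weyl s\<^esub> (weyl_gen s v \<otimes>\<^bsub>weyl s\<^esub> weyl_gen s w \<oplus>\<^bsub>weyl s\<^esub>
                      weyl_gen s w \<otimes>\<^bsub>weyl s\<^esub> weyl_gen s v) | v w. True}"

text \<open>The identification of \<open>sp(W)\<close> with \<open>weyl2\<close>, inverse to the adjoint action on \<open>W\<close>.\<close>

definition sp_to_weyl ::
    "('w::euclidean_space \<Rightarrow> 'w \<Rightarrow> real) \<Rightarrow> ('w cplx \<Rightarrow> 'w cplx)
      \<Rightarrow> ('w cplx word \<Rightarrow>\<^sub>0 complex) set" where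
  "sp_to_weyl s X = (THE q. q \<in> weyl2 s \<and>
     (\<forall>w. q \<otimes>\<^bsub>weyl s\<^esub> weyl_gen s w \<ominus>\<^bsub>weyl s\<^esub> weyl_gen s w \<otimes>\<^bsub>weyl s\<^esub> q = weyl_gen s (X w)))"

text \<open>
  \<open>f\<close> is the homomorphism from the enveloping algebra of \<open>g\<close> to the Weyl algebra extending the
  inclusion of \<open>g\<close> into \<open>sp(W) = weyl2\<close>.  It exists and is unique on the carrier.
\<close>

definition canonical_hom ::
    "('w::euclidean_space \<Rightarrow> 'w \<Rightarrow> real) \<Rightarrow> ('w cplx \<Rightarrow> 'w cplx) set
      \<Rightarrow> ((('w cplx \<Rightarrow> 'w cplx) word \<Rightarrow>\<^sub>0 complex) set \<Rightarrow> ('w cplx word \<Rightarrow>\<^sub>0 complex) set) \<Rightarrow> bool"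
  where
  "canonical_hom s g f \<longleftrightarrow>
     f \<in> ring_hom (enveloping g) (weyl s) \<and> linear_map (enveloping g) (weyl s) f \<and>
     (\<forall>X\<in>g. f (enveloping_gen g X) = sp_to_weyl s X)"

definition transfer ::
    "('w::euclidean_space \<Rightarrow> 'w \<Rightarrow> real) \<Rightarrow> ('w cplx \<Rightarrow> 'w cplx) set
      \<Rightarrow> ((('w cplx \<Rightarrow> 'w cplx) word \<Rightarrow>\<^sub>0 complex) set \<Rightarrow> ('w cplx word \<Rightarrow>\<^sub>0 complex) set)
      \<Rightarrow> ((('w cplx \<Rightarrow> 'w cplx) word \<Rightarrow>\<^sub>0 complex) set \<Rightarrow> ('w cplx word \<Rightarrow>\<^sub>0 complex) set)
      \<Rightarrow> (('w cplx \<Rightarrow> 'w cplx) word \<Rightarrow>\<^sub>0 complex) set set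
      \<Rightarrow> (('w cplx \<Rightarrow> 'w cplx) word \<Rightarrow>\<^sub>0 complex) set set" where
  "transfer s g L R I' =
     {u \<in> carrier (enveloping g). R u \<in> generated_right_ideal (weyl s) (L ` I')}"

section \<open>Harish-Chandra modules\<close>

record ('v, 'x, 'k) hc_module = "(complex, 'v) module" +
  lie_act :: "'x \<Rightarrow> 'v \<Rightarrow> 'v"
  grp_act :: "'k \<Rightarrow> 'v \<Rightarrow> 'v"

text \<open>
  Harish-Chandra modules of the preimage of \<open>G\<close> in the metaplectic group, with respect to the preimage
  of \<open>K \<inter> G\<close>.  The group action is locally finite, so continuity and the derivative along a
  one-parameter subgroup can be expressed through matrix coefficients \<open>l (m v)\<close>.
\<close>

definition harish_chandra_module ::
    "'m::topological_space monoid \<Rightarrow> ('m \<Rightarrow> 'w::euclidean_space \<Rightarrow>\<^sub>L 'w)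
      \<Rightarrow> ('w \<Rightarrow>\<^sub>L 'w) set \<Rightarrow> ('w \<Rightarrow>\<^sub>L 'w) set
      \<Rightarrow> ('v, 'w cplx \<Rightarrow> 'w cplx, 'm) hc_module \<Rightarrow> bool" where
  "harish_chandra_module Mp p K G V \<longleftrightarrow>
     (let g = complexified_lie G; H = cover_preimage Mp p (K \<inter> G) in
      complex_space V \<and>
      (\<forall>X\<in>g. linear_map V V (lie_act V X)) \<and>
      (\<forall>X\<in>g. \<forall>Y\<in>g. \<forall>v\<in>carrier V.
         lie_act V (X \<oplus>\<^bsub>endo_lie g\<^esub> Y) v = lie_act V X v \<oplus>\<^bsub>V\<^esub> lie_act V Y v) \<and>
      (\<forall>c. \<forall>X\<in>g. \<forall>v\<in>carrier V. lie_act V (c \<odot>\<^bsub>endo_lie g\<^esub> X) v = c \<odot>\<^bsub>V\<^esub> lie_act V X v) \<and>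
      (\<forall>X\<in>g. \<forall>Y\<in>g. \<forall>v\<in>carrier V.
         lie_act V (X \<otimes>\<^bsub>endo_lie g\<^esub> Y) v =
           lie_act V X (lie_act V Y v) \<ominus>\<^bsub>V\<^esub> lie_act V Y (lie_act V X v)) \<and>
      (\<forall>m\<in>H. linear_map V V (grp_act V m)) \<and>
      (\<forall>v\<in>carrier V. grp_act V \<one>\<^bsub>Mp\<^esub> v = v) \<and>
      (\<forall>m\<in>H. \<forall>n\<in>H. \<forall>v\<in>carrier V. grp_act V (m \<otimes>\<^bsub>Mp\<^esub> n) v = grp_act V m (grp_act V n v)) \<and>
      (\<forall>v\<in>carrier V. finite_dim V ((\<lambda>m. grp_act V m v) ` H)) \<and>
      (\<forall>v\<in>carrier V. \<forall>l. linear_functional V l \<longrightarrow>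
         continuous_on H (\<lambda>m. l (grp_act V m v))) \<and>
      (\<forall>m\<in>H. \<forall>X\<in>g. \<forall>v\<in>carrier V.
         grp_act V m (lie_act V X v) =
         lie_act V (cplx_endo (p m) 0 \<circ> X \<circ> cplx_endo (p (inv\<^bsub>Mp\<^esub> m)) 0) (grp_act V m v)) \<and>
      (\<forall>X\<in>real_lie (K \<inter> G). \<forall>c::real \<Rightarrow> 'm.
         continuous_on UNIV c \<and> (\<forall>t. c t \<in> carrier Mp) \<and>
         (\<forall>t u. c (t + u) = c t \<otimes>\<^bsub>Mp\<^esub> c u) \<and> (\<forall>t. p (c t) = endo_exp (t *\<^sub>R X)) \<longrightarrow>
         (\<forall>v\<in>carrier V. \<forall>l. linear_functional V l \<longrightarrow>
            ((\<lambda>t. l (grp_act V (c t) v)) has_vector_derivative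
               l (lie_act V (cplx_endo X 0) v)) (at 0))))"

definition irreducible_hc_module ::
    "'m::topological_space monoid \<Rightarrow> ('m \<Rightarrow> 'w::euclidean_space \<Rightarrow>\<^sub>L 'w)
      \<Rightarrow> ('w \<Rightarrow>\<^sub>L 'w) set \<Rightarrow> ('w \<Rightarrow>\<^sub>L 'w) set
      \<Rightarrow> ('v, 'w cplx \<Rightarrow> 'w cplx, 'm) hc_module \<Rightarrow> bool" where
  "irreducible_hc_module Mp p K G V \<longleftrightarrow>
     carrier V \<noteq> {\<zero>\<^bsub>V\<^esub>} \<and>
     (\<forall>N. complex_subspace N V \<and>
          (\<forall>X\<in>complexified_lie G. lie_act V X ` N \<subseteq> N) \<and>
          (\<forall>m\<in>cover_preimage Mp p (K \<inter> G). grp_act V m ` N \<subseteq> N)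
        \<longrightarrow> N = {\<zero>\<^bsub>V\<^esub>} \<or> N = carrier V)"

text \<open>Finite-dimensional irreducible subrepresentations of the group \<open>H\<close>.\<close>

definition irreducible_K_subspace ::
    "'k set \<Rightarrow> ('v, 'x, 'k) hc_module \<Rightarrow> 'v set \<Rightarrow> bool" where
  "irreducible_K_subspace H V E \<longleftrightarrow>
     complex_subspace E V \<and> finite_dim V E \<and> (\<forall>m\<in>H. grp_act V m ` E \<subseteq> E) \<and> E \<noteq> {\<zero>\<^bsub>V\<^esub>} \<and>
     (\<forall>N. complex_subspace N V \<and> N \<subseteq> E \<and> (\<forall>m\<in>H. grp_act V m ` N \<subseteq> N)
        \<longrightarrow> N = {\<zero>\<^bsub>V\<^esub>} \<or> N = E)"

definition K_equivalent ::
    "'k set \<Rightarrow> ('v, 'x, 'k) hc_module \<Rightarrow> 'v set \<Rightarrow> 'v set \<Rightarrow> bool" where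
  "K_equivalent H V E F \<longleftrightarrow>
     (\<exists>f. linear_map (V\<lparr>carrier := E\<rparr>) (V\<lparr>carrier := F\<rparr>) f \<and> bij_betw f E F \<and>
        (\<forall>m\<in>H. \<forall>v\<in>E. f (grp_act V m v) = grp_act V m (f v)))"

text \<open>Every \<open>K\<close>-type has a finite-dimensional isotypic component, i.e. finite multiplicity.\<close>

definition admissible_hc_module ::
    "'m::topological_space monoid \<Rightarrow> ('m \<Rightarrow> 'w::euclidean_space \<Rightarrow>\<^sub>L 'w)
      \<Rightarrow> ('w \<Rightarrow>\<^sub>L 'w) set \<Rightarrow> ('w \<Rightarrow>\<^sub>L 'w) set
      \<Rightarrow> ('v, 'w cplx \<Rightarrow> 'w cplx, 'm) hc_module \<Rightarrow> bool" where
  "admissible_hc_module Mp p K G V \<longleftrightarrow>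
     (let H = cover_preimage Mp p (K \<inter> G) in
      \<forall>E. irreducible_K_subspace H V E \<longrightarrow>
        finite_dim V (\<Union>{F. irreducible_K_subspace H V F \<and> K_equivalent H V E F}))"

definition irreducible_admissible ::
    "'m::topological_space monoid \<Rightarrow> ('m \<Rightarrow> 'w::euclidean_space \<Rightarrow>\<^sub>L 'w)
      \<Rightarrow> ('w \<Rightarrow>\<^sub>L 'w) set \<Rightarrow> ('w \<Rightarrow>\<^sub>L 'w) set
      \<Rightarrow> ('v, 'w cplx \<Rightarrow> 'w cplx, 'm) hc_module \<Rightarrow> bool" where
  "irreducible_admissible Mp p K G V \<longleftrightarrow>
     harish_chandra_module Mp p K G V \<and> irreducible_hc_module Mp p K G V \<and>
     admissible_hc_module Mp p K G V"

text \<open>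
  The elements of the enveloping algebra are cosets in the free algebra on \<open>g\<close>, all of whose
  representatives act in the same way.
\<close>

definition annihilator ::
    "('w::euclidean_space cplx \<Rightarrow> 'w cplx) set \<Rightarrow> ('v, 'w cplx \<Rightarrow> 'w cplx, 'm) hc_module
      \<Rightarrow> (('w cplx \<Rightarrow> 'w cplx) word \<Rightarrow>\<^sub>0 complex) set set" where
  "annihilator g V =
     {u \<in> carrier (enveloping g). \<forall>t\<in>u. \<forall>v\<in>carrier V. free_act V (lie_act V) t v = \<zero>\<^bsub>V\<^esub>}"

section \<open>The oscillator representation and Howe duality\<close>

text \<open>
  The maximal compact subgroups of \<open>Sp(W0)\<close> are the unitary groups of the complex structures \<open>J\<close>
  for which \<open>s x (J y)\<close> is a definite form.  Given \<open>K\<close>, such a \<open>J\<close> is unique up to sign.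
\<close>

definition compatible_complex_structure ::
    "('w::euclidean_space \<Rightarrow> 'w \<Rightarrow> real) \<Rightarrow> ('w \<Rightarrow>\<^sub>L 'w) set \<Rightarrow> ('w \<Rightarrow>\<^sub>L 'w) \<Rightarrow> bool" where
  "compatible_complex_structure s K J \<longleftrightarrow>
     J \<in> carrier (Sp s) \<and> J o\<^sub>L J = - id_blinfun \<and>
     ((\<forall>x. x \<noteq> 0 \<longrightarrow> s x (blinfun_apply J x) > 0) \<or>
      (\<forall>x. x \<noteq> 0 \<longrightarrow> s x (blinfun_apply J x) < 0)) \<and>
     K = Sp_centralizer s {J}"

text \<open>
  The Fock space: the cyclic module over the Weyl algebra generated by a vacuum vector which is
  killed by the annihilation operators, i.e. by the \<open>i\<close>-eigenspace of \<open>J\<close> in \<open>W\<close>.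
\<close>

definition fock_ideal ::
    "('w::euclidean_space \<Rightarrow> 'w \<Rightarrow> real) \<Rightarrow> ('w \<Rightarrow>\<^sub>L 'w) \<Rightarrow> ('w cplx word \<Rightarrow>\<^sub>0 complex) set set" where
  "fock_ideal s J = generated_left_ideal (weyl s)
     (weyl_gen s ` {v. cplx_endo J 0 v = cplx_scale \<i> v})"

definition fock_space ::
    "('w::euclidean_space \<Rightarrow> 'w \<Rightarrow> real) \<Rightarrow> ('w \<Rightarrow>\<^sub>L 'w)
      \<Rightarrow> (complex, ('w cplx word \<Rightarrow>\<^sub>0 complex) set set) module" where
  "fock_space s J = quot_space (weyl s) (fock_ideal s J)"

definition weyl_act ::
    "('w::euclidean_space \<Rightarrow> 'w \<Rightarrow> real) \<Rightarrow> ('w \<Rightarrow>\<^sub>L 'w) \<Rightarrow> ('w cplx word \<Rightarrow>\<^sub>0 complex) set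
      \<Rightarrow> ('w cplx word \<Rightarrow>\<^sub>0 complex) set set \<Rightarrow> ('w cplx word \<Rightarrow>\<^sub>0 complex) set set" where
  "weyl_act s J a = quot_map (weyl s) (fock_ideal s J) (\<lambda>x. a \<otimes>\<^bsub>weyl s\<^esub> x)"

text \<open>
  The Harish-Chandra module of the oscillator representation in the Fock model.  The Lie algebra
  \<open>sp(W) = weyl2\<close> acts through the Weyl algebra.  The preimage of \<open>K\<close> is connected, so its action
  \<open>a\<close> is determined by the Lie algebra action (and is the usual one, through a square root of the
  determinant on the vacuum).  The two signs of \<open>J\<close> give the oscillator representation and its
  contragredient; which of them is called the oscillator representation depends on the choice of a
  central character of the Heisenberg group.
\<close>

definition oscillator_module ::
    "('w::euclidean_space \<Rightarrow> 'w \<Rightarrow> real) \<Rightarrow> 'm::topological_space monoid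
      \<Rightarrow> ('m \<Rightarrow> 'w \<Rightarrow>\<^sub>L 'w) \<Rightarrow> ('w \<Rightarrow>\<^sub>L 'w) set
      \<Rightarrow> (('w cplx word \<Rightarrow>\<^sub>0 complex) set set, 'w cplx \<Rightarrow> 'w cplx, 'm) hc_module \<Rightarrow> bool" where
  "oscillator_module s Mp p K \<omega> \<longleftrightarrow>
     (\<exists>J a. compatible_complex_structure s K J \<and>
        \<omega> = module.extend (fock_space s J)
              (hc_module.fields (\<lambda>X. weyl_act s J (sp_to_weyl s X)) a) \<and>
        harish_chandra_module Mp p K (carrier (Sp s)) \<omega>)"

definition howe_correspondence ::
    "'m::topological_space monoid \<Rightarrow> ('m \<Rightarrow> 'w::euclidean_space \<Rightarrow>\<^sub>L 'w)
      \<Rightarrow> ('w \<Rightarrow>\<^sub>L 'w) set \<Rightarrow> ('w \<Rightarrow>\<^sub>L 'w) set \<Rightarrow> ('w \<Rightarrow>\<^sub>L 'w) set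
      \<Rightarrow> ('o, 'w cplx \<Rightarrow> 'w cplx, 'm) hc_module
      \<Rightarrow> ('v, 'w cplx \<Rightarrow> 'w cplx, 'm) hc_module
      \<Rightarrow> ('u, 'w cplx \<Rightarrow> 'w cplx, 'm) hc_module \<Rightarrow> bool" where
  "howe_correspondence Mp p K G G' \<omega> \<rho> \<rho>' \<longleftrightarrow>
     (let g = complexified_lie G; g' = complexified_lie G';
          H = cover_preimage Mp p (K \<inter> G); H' = cover_preimage Mp p (K \<inter> G') in
      \<exists>\<omega>\<^sub>0. complex_subspace \<omega>\<^sub>0 \<omega> \<and>
        (\<forall>X\<in>g \<union> g'. lie_act \<omega> X ` \<omega>\<^sub>0 \<subseteq> \<omega>\<^sub>0) \<and> (\<forall>m\<in>H \<union> H'. grp_act \<omega> m ` \<omega>\<^sub>0 \<subseteq> \<omega>\<^sub>0) \<and>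
        (\<exists>\<Phi>. linear_map (quot_space \<omega> \<omega>\<^sub>0) (tensor \<rho> \<rho>') \<Phi> \<and>
           bij_betw \<Phi> (carrier (quot_space \<omega> \<omega>\<^sub>0)) (carrier (tensor \<rho> \<rho>')) \<and>
           (\<forall>x\<in>carrier (quot_space \<omega> \<omega>\<^sub>0).
              (\<forall>X\<in>g. \<Phi> (quot_map \<omega> \<omega>\<^sub>0 (lie_act \<omega> X) x) =
                      tensor_map \<rho> \<rho>' (lie_act \<rho> X) id (\<Phi> x)) \<and>
              (\<forall>Y\<in>g'. \<Phi> (quot_map \<omega> \<omega>\<^sub>0 (lie_act \<omega> Y) x) =
                      tensor_map \<rho> \<rho>' id (lie_act \<rho>' Y) (\<Phi> x)) \<and>
              (\<forall>m\<in>H. \<Phi> (quot_map \<omega> \<omega>\<^sub>0 (grp_act \<omega> m) x) =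
                      tensor_map \<rho> \<rho>' (grp_act \<rho> m) id (\<Phi> x)) \<and>
              (\<forall>n\<in>H'. \<Phi> (quot_map \<omega> \<omega>\<^sub>0 (grp_act \<omega> n) x) =
                      tensor_map \<rho> \<rho>' id (grp_act \<rho>' n) (\<Phi> x)))))"

end

theory Submission
  imports Defs
begin

text \<open>
  Write \<open>q : \<omega> \<rightarrow> \<rho> \<otimes> \<rho>'\<close> for the projection onto the quotient \<open>\<omega> / \<omega>\<^sub>0\<close> followed by its identification
  with \<open>\<rho> \<otimes> \<rho>'\<close>.  The oscillator representation is a module over the whole Weyl algebra, and \<open>\<gg>\<close> and \<open>\<gg>'\<close>
  act on it through \<open>R\<close> and \<open>L\<close>.
  
  If \<open>R u\<close> is a sum of products \<open>L x w\<close> with \<open>x\<close> in the annihilator of \<open>\<rho>'\<close> and \<open>w\<close> in the Weyl algebra,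
  then \<open>q (R u y)\<close> is the sum of the \<open>q (L x (w y))\<close>.  Each of these vanishes, because \<open>L x\<close> acts on
  \<open>\<rho> \<otimes> \<rho>'\<close> as \<open>1 \<otimes> x = 0\<close>, and the vector \<open>w y\<close> on which it operates is again in \<open>\<omega>\<close>.  It is here
  that the right ideal, as opposed to the left one, matters.  On the other hand \<open>R u\<close> acts on
  \<open>\<rho> \<otimes> \<rho>'\<close> as \<open>u \<otimes> 1\<close>.  So \<open>u v \<otimes> v' = 0\<close> for all \<open>v\<close> and \<open>v'\<close>, and as \<open>\<rho>'\<close> is not zero, \<open>u v = 0\<close>.
  
  This argument is \<open>right_ideal_annihilates\<close>, stated for an arbitrary algebra acting on a space.  It
  rests on \<open>intertwining_extends\<close>, which extends the equivariance of \<open>q\<close> from the generators of an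
  enveloping algebra to all its elements, on \<open>tensor_induct\<close>, and on \<open>pure_tensor_eq_zeroD\<close>: in a
  tensor product of vector spaces, \<open>v \<otimes> u\<close> is zero only if a factor is.  The action of
  the Weyl algebra on Fock space comes from \<open>quotient_action\<close>, and \<open>relations_closed_of_hom\<close> ensures
  that the relators of both enveloping algebras lie in the free algebra on \<open>\<gg>\<close> or \<open>\<gg>'\<close>.
\<close>

section \<open>Linear algebra over the complex numbers\<close>

lemma complex_field_simps [simp]:
  "carrier complex_field = UNIV" "x \<otimes>\<^bsub>complex_field\<^esub> y = x * y" "\<one>\<^bsub>complex_field\<^esub> = 1"
  "\<zero>\<^bsub>complex_field\<^esub> = 0" "x \<oplus>\<^bsub>complex_field\<^esub> y = x + y"
  by (auto simp: complex_field_def)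

lemma cring_complex_field: "cring complex_field"
proof (rule cringI)
  show "abelian_group complex_field"
    by (rule abelian_groupI)
       (auto simp: complex_field_def add.commute intro: exI[of _ "- x" for x])
  show "comm_monoid complex_field"
    by (rule comm_monoidI) (auto simp: complex_field_def)
qed (auto simp: complex_field_def distrib_right)

lemma complex_spaceI:
  fixes V :: "(complex, 'v, 'z) module_scheme" (structure)
  assumes "abelian_group V"
    and "\<And>a x. x \<in> carrier V \<Longrightarrow> a \<odot> x \<in> carrier V"
    and "\<And>a b x. x \<in> carrier V \<Longrightarrow> (a + b) \<odot> x = a \<odot> x \<oplus> b \<odot> x"
    and "\<And>a x y. x \<in> carrier V \<Longrightarrow> y \<in> carrier V \<Longrightarrow> a \<odot> (x \<oplus> y) = a \<odot> x \<oplus> a \<odot> y"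
    and "\<And>a b x. x \<in> carrier V \<Longrightarrow> (a * b) \<odot> x = a \<odot> (b \<odot> x)"
    and "\<And>x. x \<in> carrier V \<Longrightarrow> 1 \<odot> x = x"
  shows "complex_space V"
  by (rule moduleI) (use assms in \<open>auto simp: cring_complex_field\<close>)

lemma complex_subspaceI:
  assumes "complex_space V" "N \<subseteq> carrier V" "\<zero>\<^bsub>V\<^esub> \<in> N"
    and "\<And>x y. x \<in> N \<Longrightarrow> y \<in> N \<Longrightarrow> x \<oplus>\<^bsub>V\<^esub> y \<in> N"
    and "\<And>c x. x \<in> N \<Longrightarrow> c \<odot>\<^bsub>V\<^esub> x \<in> N"
  shows "complex_subspace N V"
proof -
  interpret V: Module.module complex_field V by fact
  have "\<ominus>\<^bsub>V\<^esub> x \<in> N" if "x \<in> N" for x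
    using assms(5)[OF that, of "-1"] V.smult_l_minus[of 1 x] that assms(2)
    by (metis V.R.ring_simprules(18) V.add.inv_closed V.R.minus_equality
        complex_field_simps V.smult_one V.R.one_closed ab_left_minus UNIV_I in_mono)
  then show ?thesis using assms by (intro V.submoduleI) auto
qed

lemma complex_subspaceD:
  assumes "complex_space V" "complex_subspace N V"
  shows "N \<subseteq> carrier V" "\<zero>\<^bsub>V\<^esub> \<in> N"
    "\<And>x y. x \<in> N \<Longrightarrow> y \<in> N \<Longrightarrow> x \<oplus>\<^bsub>V\<^esub> y \<in> N"
    "\<And>c x. x \<in> N \<Longrightarrow> c \<odot>\<^bsub>V\<^esub> x \<in> N"
    "abelian_subgroup N V"
proof -
  interpret V: Module.module complex_field V by fact
  interpret N: submodule N complex_field V by fact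
  show "N \<subseteq> carrier V" "\<zero>\<^bsub>V\<^esub> \<in> N"
    "\<And>x y. x \<in> N \<Longrightarrow> y \<in> N \<Longrightarrow> x \<oplus>\<^bsub>V\<^esub> y \<in> N"
    "\<And>c x. x \<in> N \<Longrightarrow> c \<odot>\<^bsub>V\<^esub> x \<in> N"
    using N.subset N.one_closed N.m_closed N.smult_closed by auto
  show "abelian_subgroup N V"
    by (intro abelian_subgroupI3 additive_subgroupI N.subgroup_axioms V.abelian_group_axioms)
qed

lemma complex_subspace_Inter:
  assumes "complex_space V" "\<F> \<noteq> {}" "\<And>N. N \<in> \<F> \<Longrightarrow> complex_subspace N V"
  shows "complex_subspace (\<Inter>\<F>) V"
  using assms complex_subspaceD[OF assms(1) assms(3)]
  by (intro complex_subspaceI) (fastforce+)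

lemma lin_span_props:
  assumes "complex_space V" "S \<subseteq> carrier V"
  shows "complex_subspace (lin_span V S) V" "S \<subseteq> lin_span V S"
    "\<And>N. complex_subspace N V \<Longrightarrow> S \<subseteq> N \<Longrightarrow> lin_span V S \<subseteq> N"
proof -
  have "complex_subspace (carrier V) V"
    using assms(1) Module.module.carrier_is_submodule by blast
  then show "complex_subspace (lin_span V S) V"
    unfolding lin_span_def using assms by (intro complex_subspace_Inter) auto
qed (auto simp: lin_span_def)

lemma linear_mapD:
  assumes "linear_map V U f" "x \<in> carrier V"
  shows "f x \<in> carrier U" "y \<in> carrier V \<Longrightarrow> f (x \<oplus>\<^bsub>V\<^esub> y) = f x \<oplus>\<^bsub>U\<^esub> f y"
    "f (c \<odot>\<^bsub>V\<^esub> x) = c \<odot>\<^bsub>U\<^esub> f x"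
  using assms by (auto simp: linear_map_def)

lemma complex_space_smult_0:
  assumes "complex_space V" "x \<in> carrier V" shows "0 \<odot>\<^bsub>V\<^esub> x = \<zero>\<^bsub>V\<^esub>"
proof -
  interpret V: Module.module complex_field V by fact
  show ?thesis using V.smult_l_null[OF assms(2)] by simp
qed

lemma linear_map_zero:
  assumes "complex_space V" "complex_space U" "linear_map V U f"
  shows "f \<zero>\<^bsub>V\<^esub> = \<zero>\<^bsub>U\<^esub>"
proof -
  interpret V: Module.module complex_field V by fact
  have "f \<zero>\<^bsub>V\<^esub> = f (0 \<odot>\<^bsub>V\<^esub> \<zero>\<^bsub>V\<^esub>)" using complex_space_smult_0[OF assms(1)] by simp
  also have "\<dots> = \<zero>\<^bsub>U\<^esub>"
    using linear_mapD(1,3)[OF assms(3) V.zero_closed] complex_space_smult_0[OF assms(2)] by metis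
  finally show ?thesis .
qed

section \<open>Quotient spaces\<close>

lemma quot_space_simps:
  "carrier (quot_space V N) = a_rcosets\<^bsub>V\<^esub> N" "\<zero>\<^bsub>quot_space V N\<^esub> = N"
  "(\<oplus>\<^bsub>quot_space V N\<^esub>) = (<+>\<^bsub>V\<^esub>)" "\<one>\<^bsub>quot_space V N\<^esub> = N +>\<^bsub>V\<^esub> \<one>\<^bsub>V\<^esub>"
  "X \<otimes>\<^bsub>quot_space V N\<^esub> Y = rcoset_mult V N X Y"
  "c \<odot>\<^bsub>quot_space V N\<^esub> X = quot_map V N (\<lambda>x. c \<odot>\<^bsub>V\<^esub> x) X"
  by (simp_all add: quot_space_def FactRing_def ring.defs module.defs)

lemma carrier_quot_space: "carrier (quot_space V N) = (\<lambda>x. N +>\<^bsub>V\<^esub> x) ` carrier V"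
  by (auto simp: quot_space_simps A_RCOSETS_def')

lemma quot_map_coset:
  assumes "complex_space V" "complex_subspace N V" "f \<in> carrier V \<rightarrow> carrier V" "f ` N \<subseteq> N"
    and "\<And>x y. x \<in> carrier V \<Longrightarrow> y \<in> carrier V \<Longrightarrow> f (x \<oplus>\<^bsub>V\<^esub> y) = f x \<oplus>\<^bsub>V\<^esub> f y"
    and x: "x \<in> carrier V"
  shows "quot_map V N f (N +>\<^bsub>V\<^esub> x) = N +>\<^bsub>V\<^esub> f x"
proof -
  interpret N: abelian_subgroup N V using complex_subspaceD(5)[OF assms(1,2)] .
  have sub: "subgroup N (add_monoid V)" by (rule N.a_subgroup)
  have "N +>\<^bsub>V\<^esub> f y = N +>\<^bsub>V\<^esub> f x" if y: "y \<in> N +>\<^bsub>V\<^esub> x" for y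
  proof -
    obtain n where n: "n \<in> N" "y = n \<oplus>\<^bsub>V\<^esub> x" using y by (auto simp: a_r_coset_def')
    have "f y = f n \<oplus>\<^bsub>V\<^esub> f x" using n x assms(5) by auto
    then have "f y \<in> N +>\<^bsub>V\<^esub> f x" using n assms(4) by (auto simp: a_r_coset_def')
    then show ?thesis using N.a_repr_independence'[of "f y" "f x"] assms(3) x by auto
  qed
  moreover have "x \<in> N +>\<^bsub>V\<^esub> x" by (rule N.a_rcos_self[OF x])
  ultimately show ?thesis unfolding quot_map_def by blast
qed

lemma coset_eqI:
  assumes "complex_space V" "complex_subspace N V" "y \<in> carrier V" "z \<in> N" "x = z \<oplus>\<^bsub>V\<^esub> y"
  shows "N +>\<^bsub>V\<^esub> x = N +>\<^bsub>V\<^esub> y"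
proof -
  interpret N: abelian_subgroup N V using complex_subspaceD(5)[OF assms(1,2)] .
  show ?thesis using assms N.a_repr_independence'[of x y] by (auto simp: a_r_coset_def')
qed

lemma coset_add:
  assumes "complex_space V" "complex_subspace N V" "x \<in> carrier V" "y \<in> carrier V"
  shows "(N +>\<^bsub>V\<^esub> x) \<oplus>\<^bsub>quot_space V N\<^esub> (N +>\<^bsub>V\<^esub> y) = N +>\<^bsub>V\<^esub> (x \<oplus>\<^bsub>V\<^esub> y)"
  using abelian_subgroup.a_rcos_sum[OF complex_subspaceD(5)[OF assms(1,2)] assms(3,4)]
  by (simp add: quot_space_simps)

lemma coset_smult:
  assumes "complex_space V" "complex_subspace N V" "x \<in> carrier V"
  shows "c \<odot>\<^bsub>quot_space V N\<^esub> (N +>\<^bsub>V\<^esub> x) = N +>\<^bsub>V\<^esub> (c \<odot>\<^bsub>V\<^esub> x)"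
proof -
  interpret V: Module.module complex_field V by fact
  show ?thesis unfolding quot_space_simps
    by (rule quot_map_coset[OF assms(1,2)])
       (use assms complex_subspaceD(4)[OF assms(1,2)] V.smult_r_distr in auto)
qed

lemma coset_eq_iff:
  assumes "complex_space V" "complex_subspace N V" "x \<in> carrier V"
  shows "N +>\<^bsub>V\<^esub> x = N \<longleftrightarrow> x \<in> N"
proof -
  interpret N: abelian_subgroup N V using complex_subspaceD(5)[OF assms(1,2)] .
  show ?thesis using N.a_rcos_self N.a_rcos_const assms(3) by blast
qed

lemma complex_space_quot_space:
  assumes V: "complex_space V" and N: "complex_subspace N V"
  shows "complex_space (quot_space V N)"
proof -
  interpret V: Module.module complex_field V by fact
  interpret N: abelian_subgroup N V using complex_subspaceD(5)[OF assms(1,2)] .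
  note add = coset_add[OF V N] and smult = coset_smult[OF V N]
  interpret Q: comm_group "V A_Mod N" by (rule N.a_factorgroup_is_comm_group)
  have grp: "abelian_group (quot_space V N)"
    by (rule abelian_groupI)
       (use Q.m_closed Q.one_closed Q.m_assoc Q.m_comm Q.l_one Q.l_inv_ex
        in \<open>simp_all add: quot_space_simps A_FactGroup_def'\<close>)
  show ?thesis
    by (rule complex_spaceI[OF grp])
       (auto simp: carrier_quot_space add smult V.smult_l_distr[simplified]
         V.smult_r_distr[simplified] V.smult_assoc1[simplified] V.smult_one[simplified])
qed

lemma linear_map_coset:
  assumes "complex_space V" "complex_subspace N V"
  shows "linear_map V (quot_space V N) (\<lambda>x. N +>\<^bsub>V\<^esub> x)"
  using coset_add[OF assms] coset_smult[OF assms]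
  by (auto simp: linear_map_def carrier_quot_space)

section \<open>Enough linear functionals\<close>

text \<open>
  By Zorn's lemma there is a maximal subspace \<open>N\<close> that misses \<open>v\<close>.  It has codimension one, because adjoining any vector outside \<open>N\<close> captures \<open>v\<close>.  The functional is the
  coordinate along \<open>v\<close> in the decomposition of the space into \<open>N\<close> and the line through \<open>v\<close>.
\<close>

lemma exists_linear_functional:
  assumes V: "complex_space V" and v: "v \<in> carrier V" "v \<noteq> \<zero>\<^bsub>V\<^esub>"
  obtains l where "linear_functional V l" "l v = 1"
proof -
  interpret V: Module.module complex_field V by fact
  note distr = V.smult_l_distr[simplified] V.smult_r_distr[simplified] V.smult_assoc1[simplified]
    V.smult_closed[simplified]
  define A where "A = {N. complex_subspace N V \<and> v \<notin> N}"
  have "\<exists>M\<in>A. \<forall>X\<in>A. M \<subseteq> X \<longrightarrow> X = M"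
  proof (rule subset_Zorn_nonempty)
    have "complex_subspace {\<zero>\<^bsub>V\<^esub>} V"
      using complex_space_smult_0[OF V] by (intro complex_subspaceI[OF V]) auto
    then show "A \<noteq> {}" using v by (auto simp: A_def)
  next
    fix C assume C: "C \<noteq> {}" "subset.chain A C"
    then have sub: "complex_subspace N V" "v \<notin> N" if "N \<in> C" for N
      using that by (auto simp: A_def subset.chain_def)
    note D = complex_subspaceD[OF V sub(1)]
    have "complex_subspace (\<Union>C) V"
    proof (rule complex_subspaceI[OF V])
      fix x y assume "x \<in> \<Union>C" "y \<in> \<Union>C"
      then obtain X Y where "x \<in> X" "X \<in> C" "y \<in> Y" "Y \<in> C" by auto
      moreover from this have "X \<subseteq> Y \<or> Y \<subseteq> X"
        using C by (auto simp: subset.chain_def)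
      ultimately show "x \<oplus>\<^bsub>V\<^esub> y \<in> \<Union>C" using D(3) by blast
    next
      show "\<zero>\<^bsub>V\<^esub> \<in> \<Union>C" using C(1) D(2) by blast
      show "\<Union>C \<subseteq> carrier V" using D(1) by blast
      show "\<And>c x. x \<in> \<Union>C \<Longrightarrow> c \<odot>\<^bsub>V\<^esub> x \<in> \<Union>C" using D(4) by blast
    qed
    then show "\<Union>C \<in> A" using sub by (auto simp: A_def)
  qed
  then obtain N where N: "complex_subspace N V" "v \<notin> N"
    and max: "\<And>X. complex_subspace X V \<Longrightarrow> v \<notin> X \<Longrightarrow> N \<subseteq> X \<Longrightarrow> X = N"
    by (auto simp: A_def)
  note D = complex_subspaceD[OF V N(1)]
  have scale: "c = 0" if "c \<odot>\<^bsub>V\<^esub> v \<in> N" for c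
  proof (rule ccontr)
    assume "c \<noteq> 0"
    then have "v = (1/c) \<odot>\<^bsub>V\<^esub> (c \<odot>\<^bsub>V\<^esub> v)"
      using v distr(3)[of v "1/c" c] V.smult_one[of v] by simp
    then show False using D(4)[OF that, of "1/c"] N(2) by auto
  qed
  have decomp: "\<exists>c. \<exists>n\<in>N. x = n \<oplus>\<^bsub>V\<^esub> c \<odot>\<^bsub>V\<^esub> v" if x: "x \<in> carrier V" for x
  proof (cases "x \<in> N")
    case True
    then show ?thesis using complex_space_smult_0[OF V v(1)] D(1) x
      by (intro exI[of _ 0] bexI[of _ x]) auto
  next
    case False
    \<comment> \<open>By maximality, the span of \<open>N\<close> and \<open>x\<close> contains \<open>v\<close>; solving for \<open>x\<close> gives the decomposition.\<close>
    define X where "X = {n \<oplus>\<^bsub>V\<^esub> c \<odot>\<^bsub>V\<^esub> x | n c. n \<in> N}"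
    have "complex_subspace X V"
    proof (rule complex_subspaceI[OF V])
      show "X \<subseteq> carrier V" using D(1) x distr by (auto simp: X_def)
      show "\<zero>\<^bsub>V\<^esub> \<in> X" using D(2) x complex_space_smult_0[OF V x]
        by (auto simp: X_def intro!: exI[of _ "\<zero>\<^bsub>V\<^esub>"] exI[of _ 0])
      fix a b assume "a \<in> X" "b \<in> X"
      then obtain n c m d where "n \<in> N" "m \<in> N" "a = n \<oplus>\<^bsub>V\<^esub> c \<odot>\<^bsub>V\<^esub> x" "b = m \<oplus>\<^bsub>V\<^esub> d \<odot>\<^bsub>V\<^esub> x"
        by (auto simp: X_def)
      moreover from this have "a \<oplus>\<^bsub>V\<^esub> b = (n \<oplus>\<^bsub>V\<^esub> m) \<oplus>\<^bsub>V\<^esub> (c + d) \<odot>\<^bsub>V\<^esub> x"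
        using D(1) x by (subst distr(1)) (auto simp: distr V.a_ac subset_iff)
      ultimately show "a \<oplus>\<^bsub>V\<^esub> b \<in> X" using D(3) unfolding X_def by blast
    next
      fix e a assume "a \<in> X"
      then obtain n c where n: "n \<in> N" "a = n \<oplus>\<^bsub>V\<^esub> c \<odot>\<^bsub>V\<^esub> x" by (auto simp: X_def)
      then have "e \<odot>\<^bsub>V\<^esub> a = e \<odot>\<^bsub>V\<^esub> n \<oplus>\<^bsub>V\<^esub> (e * c) \<odot>\<^bsub>V\<^esub> x"
        using D(1) x distr(2)[of n "c \<odot>\<^bsub>V\<^esub> x" e] distr(3)[of x e c] distr(4) by auto
      then show "e \<odot>\<^bsub>V\<^esub> a \<in> X" using D(4) n unfolding X_def by blast
    qed
    moreover have "N \<subseteq> X"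
    proof
      fix n assume "n \<in> N"
      moreover from this have "n = n \<oplus>\<^bsub>V\<^esub> 0 \<odot>\<^bsub>V\<^esub> x"
        using D(1) x complex_space_smult_0[OF V x] by auto
      ultimately show "n \<in> X" unfolding X_def by blast
    qed
    moreover have "x \<in> X"
      using D(2) x V.smult_one[of x]
      by (auto simp: X_def intro!: exI[of _ "\<zero>\<^bsub>V\<^esub>"] exI[of _ 1])
    ultimately have "v \<in> X" using max False by blast
    then obtain n c where n: "n \<in> N" and veq: "v = n \<oplus>\<^bsub>V\<^esub> c \<odot>\<^bsub>V\<^esub> x" by (auto simp: X_def)
    have c: "c \<noteq> 0"
    proof
      assume "c = 0"
      then have "v = n" using veq D(1) n complex_space_smult_0[OF V x] by auto
      then show False using n N(2) by simp
    qed
    have nc: "n \<in> carrier V" using n D(1) by auto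
    have "(1/c) \<odot>\<^bsub>V\<^esub> v = (1/c) \<odot>\<^bsub>V\<^esub> n \<oplus>\<^bsub>V\<^esub> (1/c) \<odot>\<^bsub>V\<^esub> (c \<odot>\<^bsub>V\<^esub> x)"
      using veq nc x by (simp add: distr)
    also have "(1/c) \<odot>\<^bsub>V\<^esub> (c \<odot>\<^bsub>V\<^esub> x) = x"
      using distr(3)[OF x, of "1/c" c] c V.smult_one[OF x] by simp
    finally have eq: "(1/c) \<odot>\<^bsub>V\<^esub> v = (1/c) \<odot>\<^bsub>V\<^esub> n \<oplus>\<^bsub>V\<^esub> x" .
    have "(-1/c) \<odot>\<^bsub>V\<^esub> n \<oplus>\<^bsub>V\<^esub> (1/c) \<odot>\<^bsub>V\<^esub> n = \<zero>\<^bsub>V\<^esub>"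
      using distr(1)[OF nc, of "-1/c" "1/c"] complex_space_smult_0[OF V nc] by simp
    then have "x = (-1/c) \<odot>\<^bsub>V\<^esub> n \<oplus>\<^bsub>V\<^esub> (1/c) \<odot>\<^bsub>V\<^esub> v"
      unfolding eq using nc x distr(4) V.a_assoc[of "(-1/c) \<odot>\<^bsub>V\<^esub> n" "(1/c) \<odot>\<^bsub>V\<^esub> n" x] by auto
    then show ?thesis using D(4)[OF n] by blast
  qed
  have unique: "c = d"
    if "n \<in> N" "m \<in> N" "n \<oplus>\<^bsub>V\<^esub> c \<odot>\<^bsub>V\<^esub> v = m \<oplus>\<^bsub>V\<^esub> d \<odot>\<^bsub>V\<^esub> v" for n m c d
  proof -
    have carr: "n \<in> carrier V" "m \<in> carrier V" using that D(1) by auto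
    have m: "(-1) \<odot>\<^bsub>V\<^esub> n \<in> N" using D(4) that by auto
    have "(c - d) \<odot>\<^bsub>V\<^esub> v = c \<odot>\<^bsub>V\<^esub> v \<oplus>\<^bsub>V\<^esub> (-d) \<odot>\<^bsub>V\<^esub> v"
      using distr(1)[OF v(1), of c "-d"] by simp
    also have "\<dots> = ((-1) \<odot>\<^bsub>V\<^esub> n \<oplus>\<^bsub>V\<^esub> n) \<oplus>\<^bsub>V\<^esub> (c \<odot>\<^bsub>V\<^esub> v \<oplus>\<^bsub>V\<^esub> (-d) \<odot>\<^bsub>V\<^esub> v)"
      using distr(1)[OF carr(1), of "-1" 1] V.smult_one[OF carr(1)] v distr(4)
        complex_space_smult_0[OF V carr(1)] V.l_zero by auto
    also have "\<dots> = (-1) \<odot>\<^bsub>V\<^esub> n \<oplus>\<^bsub>V\<^esub> ((n \<oplus>\<^bsub>V\<^esub> c \<odot>\<^bsub>V\<^esub> v) \<oplus>\<^bsub>V\<^esub> (-d) \<odot>\<^bsub>V\<^esub> v)"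
      using carr v distr(4) by (simp add: V.a_assoc)
    also have "\<dots> = (-1) \<odot>\<^bsub>V\<^esub> n \<oplus>\<^bsub>V\<^esub> (m \<oplus>\<^bsub>V\<^esub> (d \<odot>\<^bsub>V\<^esub> v \<oplus>\<^bsub>V\<^esub> (-d) \<odot>\<^bsub>V\<^esub> v))"
      unfolding that(3) using carr v distr(4) by (simp add: V.a_assoc)
    also have "d \<odot>\<^bsub>V\<^esub> v \<oplus>\<^bsub>V\<^esub> (-d) \<odot>\<^bsub>V\<^esub> v = \<zero>\<^bsub>V\<^esub>"
      using distr(1)[OF v(1), of d "-d"] complex_space_smult_0[OF V v(1)] by simp
    finally have "(c - d) \<odot>\<^bsub>V\<^esub> v \<in> N" using m that D(3) carr by auto
    then show ?thesis using scale by fastforce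
  qed
  define l where "l x = (THE c. \<exists>n\<in>N. x = n \<oplus>\<^bsub>V\<^esub> c \<odot>\<^bsub>V\<^esub> v)" for x
  have l: "l (n \<oplus>\<^bsub>V\<^esub> c \<odot>\<^bsub>V\<^esub> v) = c" if "n \<in> N" for n c
    unfolding l_def using that unique by (intro the_equality) blast+
  have "linear_functional V l"
    unfolding linear_functional_def
  proof (intro conjI ballI allI)
    fix x y assume "x \<in> carrier V" "y \<in> carrier V"
    then obtain c d n m where n: "n \<in> N" "m \<in> N"
      and eq: "x = n \<oplus>\<^bsub>V\<^esub> c \<odot>\<^bsub>V\<^esub> v" "y = m \<oplus>\<^bsub>V\<^esub> d \<odot>\<^bsub>V\<^esub> v"
      using decomp by metis
    have "x \<oplus>\<^bsub>V\<^esub> y = (n \<oplus>\<^bsub>V\<^esub> m) \<oplus>\<^bsub>V\<^esub> (c + d) \<odot>\<^bsub>V\<^esub> v"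
      using D(1) v n eq by (subst distr(1)) (auto simp: distr V.a_ac subset_iff)
    then show "l (x \<oplus>\<^bsub>V\<^esub> y) = l x + l y" using l n D(3) eq by simp
  next
    fix e x assume "x \<in> carrier V"
    then obtain c n where n: "n \<in> N" and eq: "x = n \<oplus>\<^bsub>V\<^esub> c \<odot>\<^bsub>V\<^esub> v"
      using decomp by metis
    have "e \<odot>\<^bsub>V\<^esub> x = e \<odot>\<^bsub>V\<^esub> n \<oplus>\<^bsub>V\<^esub> (e * c) \<odot>\<^bsub>V\<^esub> v"
      using D(1) v eq n distr(2)[of n "c \<odot>\<^bsub>V\<^esub> v" e] distr(3)[of v e c] distr(4) by auto
    then show "l (e \<odot>\<^bsub>V\<^esub> x) = e * l x" using l n D(4) eq by simp
  qed
  moreover have "l v = 1" using l[OF D(2), of 1] V.smult_one[of v] v by simp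
  ultimately show ?thesis using that by blast
qed

section \<open>Pure tensors\<close>

lemma lookup_scale: "Poly_Mapping.lookup (Poly_Mapping.map ((*) c) t) k = c * Poly_Mapping.lookup t k"
  for c :: complex
  by transfer (auto simp: when_def)

lemma scale_single: "Poly_Mapping.map ((*) c) (Poly_Mapping.single k a) = Poly_Mapping.single k (c * a)"
  for c :: complex
  by (rule poly_mapping_eqI) (simp add: lookup_scale lookup_single when_def)

lemma keys_scale: "Poly_Mapping.keys (Poly_Mapping.map ((*) c) t) = (if c = 0 then {} else Poly_Mapping.keys t)"
  for c :: complex
  by (auto simp: set_eq_iff Poly_Mapping.in_keys_iff lookup_scale simp del: keys_eq_empty)

lemma complex_space_free_space: "complex_space (free_space S)"
proof (rule complex_spaceI)
  show "abelian_group (free_space S)"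
  proof (rule abelian_groupI)
    fix x assume "x \<in> carrier (free_space S)"
    then show "\<exists>y\<in>carrier (free_space S). y \<oplus>\<^bsub>free_space S\<^esub> x = \<zero>\<^bsub>free_space S\<^esub>"
      by (intro bexI[of _ "- x"]) (auto simp: free_space_def)
  qed (use Poly_Mapping.keys_add in \<open>fastforce simp: free_space_def add.commute add.left_commute\<close>)+
qed (auto simp: free_space_def keys_scale lookup_scale lookup_add algebra_simps
    intro!: poly_mapping_eqI)

lemma basis_vec_carrier: "x \<in> S \<Longrightarrow> Poly_Mapping.single x c \<in> carrier (free_space S)"
  by (auto simp: free_space_def)

lemma diff_carrier_free_space:
  "x \<in> carrier (free_space S) \<Longrightarrow> y \<in> carrier (free_space S) \<Longrightarrow> x - y \<in> carrier (free_space S)"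
  using Poly_Mapping.keys_add[of x "- y"] by (auto simp: free_space_def)

lemma tensor_relations_carrier:
  assumes V: "complex_space V" and U: "complex_space U"
  shows "tensor_relations V U \<subseteq> carrier (free_space (carrier V \<times> carrier U))"
proof -
  interpret V: Module.module complex_field V by fact
  interpret U: Module.module complex_field U by fact
  show ?thesis unfolding tensor_relations_def
    by (safe intro!: diff_carrier_free_space basis_vec_carrier) auto
qed

lemma tensor_relationsI:
  assumes "x \<in> carrier V" "u \<in> carrier U"
  shows "y \<in> carrier V \<Longrightarrow>
      basis_vec (x \<oplus>\<^bsub>V\<^esub> y, u) - basis_vec (x, u) - basis_vec (y, u) \<in> tensor_relations V U"
    and "w \<in> carrier U \<Longrightarrow>
      basis_vec (x, u \<oplus>\<^bsub>U\<^esub> w) - basis_vec (x, u) - basis_vec (x, w) \<in> tensor_relations V U"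
    and "basis_vec (c \<odot>\<^bsub>V\<^esub> x, u) - Poly_Mapping.single (x, u) c \<in> tensor_relations V U"
    and "basis_vec (x, c \<odot>\<^bsub>U\<^esub> u) - Poly_Mapping.single (x, u) c \<in> tensor_relations V U"
  using assms unfolding tensor_relations_def by blast+

lemma tensor_null:
  assumes "complex_space V" "complex_space U"
  shows "complex_subspace (tensor_null V U) (free_space (carrier V \<times> carrier U))"
    "tensor_relations V U \<subseteq> tensor_null V U"
  unfolding tensor_null_def
  using lin_span_props[OF complex_space_free_space tensor_relations_carrier[OF assms]] by auto

lemma complex_space_tensor:
  "complex_space V \<Longrightarrow> complex_space U \<Longrightarrow> complex_space (tensor V U)"
  unfolding tensor_def by (intro complex_space_quot_space complex_space_free_space tensor_null)

definition pure_tensor ::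
    "(complex, 'v, 'z) module_scheme \<Rightarrow> (complex, 'u, 'y) module_scheme \<Rightarrow> 'v \<Rightarrow> 'u
      \<Rightarrow> ('v \<times> 'u \<Rightarrow>\<^sub>0 complex) set" where
  "pure_tensor V U v u =
     tensor_null V U +>\<^bsub>free_space (carrier V \<times> carrier U)\<^esub> basis_vec (v, u)"

lemma free_space_simps: "x \<oplus>\<^bsub>free_space S\<^esub> y = x + y" "\<zero>\<^bsub>free_space S\<^esub> = 0"
  "c \<odot>\<^bsub>free_space S\<^esub> x = Poly_Mapping.map ((*) c) x"
  by (auto simp: free_space_def)

lemma pure_tensor_linear:
  assumes V: "complex_space V" and U: "complex_space U"
  shows "u \<in> carrier U \<Longrightarrow> linear_map V (tensor V U) (\<lambda>v. pure_tensor V U v u)"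
    and "v \<in> carrier V \<Longrightarrow> linear_map U (tensor V U) (\<lambda>u. pure_tensor V U v u)"
proof -
  interpret V: Module.module complex_field V by fact
  interpret U: Module.module complex_field U by fact
  let ?F = "free_space (carrier V \<times> carrier U)" and ?N = "tensor_null V U"
  note F = complex_space_free_space[of "carrier V \<times> carrier U"]
  note N = tensor_null[OF V U]
  have rel: "?N +>\<^bsub>?F\<^esub> x = ?N +>\<^bsub>?F\<^esub> y"
    if "x - y \<in> tensor_relations V U" "y \<in> carrier ?F" for x y
    by (rule coset_eqI[OF F N(1) that(2)]) (use that N(2) in \<open>auto simp: free_space_simps\<close>)
  have c: "basis_vec (x, w) \<in> carrier ?F" if "x \<in> carrier V" "w \<in> carrier U" for x w
    using that by (intro basis_vec_carrier) auto
  have pure: "pure_tensor V U x w \<in> carrier (tensor V U)" if "x \<in> carrier V" "w \<in> carrier U" for x w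
    unfolding tensor_def pure_tensor_def using c[OF that] by (auto simp: carrier_quot_space)
  have add: "pure_tensor V U x w \<oplus>\<^bsub>tensor V U\<^esub> pure_tensor V U y z =
      ?N +>\<^bsub>?F\<^esub> (basis_vec (x, w) + basis_vec (y, z))"
    if "x \<in> carrier V" "w \<in> carrier U" "y \<in> carrier V" "z \<in> carrier U" for x y w z
    unfolding tensor_def pure_tensor_def
    using coset_add[OF F N(1) c c] that by (simp add: free_space_simps)
  have scale: "a \<odot>\<^bsub>tensor V U\<^esub> pure_tensor V U x w = ?N +>\<^bsub>?F\<^esub> Poly_Mapping.single (x, w) a"
    if "x \<in> carrier V" "w \<in> carrier U" for x w a
    unfolding tensor_def pure_tensor_def
    using coset_smult[OF F N(1) c] that by (simp add: free_space_simps scale_single)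
  note r = tensor_relationsI(1,2)[unfolded diff_diff_eq] tensor_relationsI(3,4)
  have c2: "basis_vec (x, w) + basis_vec (y, z) \<in> carrier ?F" "Poly_Mapping.single (x, w) a \<in> carrier ?F"
    if "x \<in> carrier V" "w \<in> carrier U" "y \<in> carrier V" "z \<in> carrier U" for x y w z a
    using that Poly_Mapping.keys_add[of "basis_vec (x, w)" "basis_vec (y, z)"]
    by (auto simp: free_space_def)
  show "linear_map V (tensor V U) (\<lambda>v. pure_tensor V U v u)" if u: "u \<in> carrier U"
    unfolding linear_map_def
  proof (intro conjI ballI allI)
    fix x y assume x: "x \<in> carrier V" and y: "y \<in> carrier V"
    then show "pure_tensor V U (x \<oplus>\<^bsub>V\<^esub> y) u =
      pure_tensor V U x u \<oplus>\<^bsub>tensor V U\<^esub> pure_tensor V U y u"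
      using add u c2 unfolding pure_tensor_def[of V U "x \<oplus>\<^bsub>V\<^esub> y"]
      by (subst add) (auto intro!: rel r)
  next
    fix a x assume x: "x \<in> carrier V"
    then show "pure_tensor V U (a \<odot>\<^bsub>V\<^esub> x) u = a \<odot>\<^bsub>tensor V U\<^esub> pure_tensor V U x u"
      using u c2 unfolding pure_tensor_def[of V U "a \<odot>\<^bsub>V\<^esub> x"]
      by (subst scale) (auto intro!: rel r)
  qed (use pure u in auto)
  show "linear_map U (tensor V U) (\<lambda>u. pure_tensor V U v u)" if v: "v \<in> carrier V"
    unfolding linear_map_def
  proof (intro conjI ballI allI)
    fix x y assume x: "x \<in> carrier U" and y: "y \<in> carrier U"
    then show "pure_tensor V U v (x \<oplus>\<^bsub>U\<^esub> y) =
      pure_tensor V U v x \<oplus>\<^bsub>tensor V U\<^esub> pure_tensor V U v y"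
      using add v c2 unfolding pure_tensor_def[of V U v "x \<oplus>\<^bsub>U\<^esub> y"]
      by (subst add) (auto intro!: rel r)
  next
    fix a x assume x: "x \<in> carrier U"
    then show "pure_tensor V U v (a \<odot>\<^bsub>U\<^esub> x) = a \<odot>\<^bsub>tensor V U\<^esub> pure_tensor V U v x"
      using v c2 unfolding pure_tensor_def[of V U v "a \<odot>\<^bsub>U\<^esub> x"]
      by (subst scale) (auto intro!: rel r)
  qed (use pure v in auto)
qed

text \<open>
  The side condition that \<open>k\<close> is a new key lets sums over the keys be split off one term at a time,
  even when they are taken in the carrier of a record rather than in a type of class
  \<open>comm_monoid_add\<close>.
\<close>

lemma poly_mapping_single_induct [consumes 1, case_names zero add]:
  fixes t :: "'a \<Rightarrow>\<^sub>0 complex"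
  assumes "Poly_Mapping.keys t \<subseteq> S"
    and "P 0"
    and "\<And>k c t. k \<in> S \<Longrightarrow> Poly_Mapping.keys t \<subseteq> S \<Longrightarrow> k \<notin> Poly_Mapping.keys t \<Longrightarrow> c \<noteq> 0 \<Longrightarrow> P t \<Longrightarrow> P (Poly_Mapping.single k c + t)"
  shows "P t"
proof -
  have "finite A \<Longrightarrow> A \<subseteq> S \<Longrightarrow> Poly_Mapping.keys t = A \<Longrightarrow> P t" for A and t :: "'a \<Rightarrow>\<^sub>0 complex"
  proof (induction A arbitrary: t rule: finite_induct)
    case empty
    then show ?case using assms(2) by simp
  next
    case (insert k A)
    define r where "r = t - Poly_Mapping.single k (Poly_Mapping.lookup t k)"
    have "Poly_Mapping.keys r = A"
      using insert unfolding r_def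
      by (auto simp: Poly_Mapping.in_keys_iff lookup_minus lookup_single when_def set_eq_iff split: if_splits)
    moreover have "t = Poly_Mapping.single k (Poly_Mapping.lookup t k) + r" by (simp add: r_def)
    moreover have "Poly_Mapping.lookup t k \<noteq> 0" using insert by (auto simp: Poly_Mapping.in_keys_iff)
    ultimately show ?case using insert assms(3) by (metis insert_subset)
  qed
  then show ?thesis using assms(1) Poly_Mapping.finite_keys by blast
qed

text \<open>
  Sums of pure tensors suffice, without scalars, because a scalar can be absorbed into the first
  factor.
\<close>

lemma tensor_induct [consumes 3, case_names zero add]:
  assumes V: "complex_space V" and U: "complex_space U" and "x \<in> carrier (tensor V U)"
    and "P \<zero>\<^bsub>tensor V U\<^esub>"
    and "\<And>v u x. v \<in> carrier V \<Longrightarrow> u \<in> carrier U \<Longrightarrow> x \<in> carrier (tensor V U) \<Longrightarrow> P x \<Longrightarrow>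
          P (pure_tensor V U v u \<oplus>\<^bsub>tensor V U\<^esub> x)"
  shows "P x"
proof -
  let ?F = "free_space (carrier V \<times> carrier U)" and ?N = "tensor_null V U"
  interpret V: Module.module complex_field V by fact
  note F = complex_space_free_space[of "carrier V \<times> carrier U"]
  note N = tensor_null[OF V U]
  interpret F: Module.module complex_field ?F by (rule F)
  obtain t where t: "Poly_Mapping.keys t \<subseteq> carrier V \<times> carrier U" and x: "x = ?N +>\<^bsub>?F\<^esub> t"
    using assms(3) by (auto simp: tensor_def carrier_quot_space free_space_def)
  have "P (?N +>\<^bsub>?F\<^esub> t)"
    using t
  proof (induction t rule: poly_mapping_single_induct)
    case zero
    have "?N +>\<^bsub>?F\<^esub> 0 = \<zero>\<^bsub>tensor V U\<^esub>"
      using complex_subspaceD(1)[OF F N(1)] F.a_coset_add_zero[of ?N]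
      by (simp add: tensor_def quot_space_simps free_space_simps)
    then show ?case using assms(4) by simp
  next
    case (add k c t)
    obtain v u where k: "k = (v, u)" "v \<in> carrier V" "u \<in> carrier U" using add(1) by auto
    have t: "t \<in> carrier ?F" using add by (auto simp: free_space_def)
    have "?N +>\<^bsub>?F\<^esub> (Poly_Mapping.single k c + t) =
        (?N +>\<^bsub>?F\<^esub> Poly_Mapping.single k c) \<oplus>\<^bsub>tensor V U\<^esub> (?N +>\<^bsub>?F\<^esub> t)"
      using coset_add[OF F N(1) basis_vec_carrier[OF add(1)] t, of c]
      by (simp add: tensor_def free_space_simps)
    also have "?N +>\<^bsub>?F\<^esub> Poly_Mapping.single k c = c \<odot>\<^bsub>tensor V U\<^esub> pure_tensor V U v u"
      using coset_smult[OF F N(1) basis_vec_carrier[OF add(1)], of c 1] k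
      by (simp add: tensor_def pure_tensor_def free_space_simps scale_single)
    also have "\<dots> = pure_tensor V U (c \<odot>\<^bsub>V\<^esub> v) u"
      using linear_mapD(3)[OF pure_tensor_linear(1)[OF V U k(3)] k(2)] by simp
    finally show ?case using assms(5)[of "c \<odot>\<^bsub>V\<^esub> v" u] k add(5) t
      by (simp add: tensor_def carrier_quot_space)
  qed
  then show ?thesis by (simp add: x)
qed

lemma linear_map_lin_span:
  assumes V: "complex_space V" and U: "complex_space U" and f: "linear_map V U f"
    and S: "complex_subspace S U" and B: "B \<subseteq> carrier V" "f ` B \<subseteq> S"
  shows "f ` lin_span V B \<subseteq> S"
proof -
  interpret V: Module.module complex_field V by fact
  have "complex_subspace {x \<in> carrier V. f x \<in> S} V"
    using complex_subspaceD(2-4)[OF U S] linear_map_zero[OF V U f] linear_mapD[OF f]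
    by (intro complex_subspaceI[OF V]) auto
  then show ?thesis using lin_span_props(3)[OF V B(1)] B by blast
qed

lemma linear_functional_lin_span:
  assumes V: "complex_space V" and l: "linear_functional V l"
    and B: "B \<subseteq> carrier V" "\<And>b. b \<in> B \<Longrightarrow> l b = 0" and x: "x \<in> lin_span V B"
  shows "l x = 0"
proof -
  interpret V: Module.module complex_field V by fact
  have "l \<zero>\<^bsub>V\<^esub> = 0"
    using l V.zero_closed complex_space_smult_0[OF V V.zero_closed]
    unfolding linear_functional_def by (metis mult_zero_left)
  then have "complex_subspace {x \<in> carrier V. l x = 0} V"
    using l by (intro complex_subspaceI[OF V]) (auto simp: linear_functional_def)
  then show ?thesis using lin_span_props(3)[OF V B(1)] B x by blast
qed

lemma sum_keys_scale:
  fixes h :: "'k \<Rightarrow> complex \<Rightarrow> 'b :: comm_monoid_add"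
  assumes "\<And>k. h k 0 = 0"
  shows "(\<Sum>k\<in>Poly_Mapping.keys (Poly_Mapping.map ((*) c) t). h k (Poly_Mapping.lookup (Poly_Mapping.map ((*) c) t) k)) =
    (\<Sum>k\<in>Poly_Mapping.keys t. h k (c * Poly_Mapping.lookup t k))"
  by (intro sum.mono_neutral_cong_left) (auto simp: keys_scale lookup_scale assms)

text \<open>
  The functional \<open>l \<otimes> m\<close>, with \<open>l v = m u = 1\<close>, exists on the free space and kills the tensor
  relations, so \<open>v \<otimes> u\<close> cannot vanish.  This is how the annihilation of \<open>v \<otimes> u\<close> by an operator on the
  first factor is turned into the annihilation of \<open>v\<close>.
\<close>

lemma pure_tensor_eq_zeroD:
  assumes V: "complex_space V" and U: "complex_space U" and v: "v \<in> carrier V" and u: "u \<in> carrier U"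
    and eq: "pure_tensor V U v u = \<zero>\<^bsub>tensor V U\<^esub>" and "u \<noteq> \<zero>\<^bsub>U\<^esub>"
  shows "v = \<zero>\<^bsub>V\<^esub>"
proof (rule ccontr)
  assume "v \<noteq> \<zero>\<^bsub>V\<^esub>"
  then obtain l where l: "linear_functional V l" "l v = 1"
    using exists_linear_functional[OF V v] by blast
  obtain m where m: "linear_functional U m" "m u = 1"
    using exists_linear_functional[OF U u \<open>u \<noteq> \<zero>\<^bsub>U\<^esub>\<close>] by blast
  let ?F = "free_space (carrier V \<times> carrier U)"
  note F = complex_space_free_space[of "carrier V \<times> carrier U"]
  define h where "h k c = c * (l (fst k) * m (snd k))" for k c
  define L where "L t = (\<Sum>k\<in>Poly_Mapping.keys t. h k (Poly_Mapping.lookup t k))" for t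
  have add: "L (s + t) = L s + L t" for s t
    unfolding L_def by (rule setsum_keys_plus_distrib) (auto simp: h_def distrib_right)
  have scale: "L (Poly_Mapping.map ((*) c) t) = c * L t" for c t
    unfolding L_def by (subst sum_keys_scale) (auto simp: h_def sum_distrib_left mult.assoc)
  have diff: "L (s - t) = L s - L t" for s t
    using add[of "s - t" t] by simp
  have single: "L (Poly_Mapping.single k c) = h k c" for k c
    by (auto simp: L_def h_def)
  have "linear_functional ?F L"
    by (simp add: linear_functional_def free_space_simps add scale)
  moreover have "L r = 0" if "r \<in> tensor_relations V U" for r
    using that l(1) m(1) unfolding tensor_relations_def linear_functional_def
    by (auto simp: diff single h_def distrib_left distrib_right mult.left_commute)
  moreover have "basis_vec (v, u) \<in> tensor_null V U"
    using eq coset_eq_iff[OF F tensor_null(1)[OF V U] basis_vec_carrier[of "(v,u)" _ 1]] v u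
    by (simp add: tensor_def pure_tensor_def quot_space_simps)
  ultimately have "L (basis_vec (v, u)) = 0"
    using linear_functional_lin_span[OF F _ tensor_relations_carrier[OF V U]]
    unfolding tensor_null_def by blast
  then show False using l m by (simp add: single h_def)
qed

text \<open>
  The map on the free space that induces \<open>f \<otimes> g\<close> takes each tensor relation to another one; this
  makes it compatible with the quotient.
\<close>

lemma tensor_map_pure:
  assumes V: "complex_space V" and U: "complex_space U"
    and f: "linear_map V V f" and g: "linear_map U U g"
    and v: "v \<in> carrier V" and u: "u \<in> carrier U"
  shows "tensor_map V U f g (pure_tensor V U v u) = pure_tensor V U (f v) (g u)"
proof -
  let ?F = "free_space (carrier V \<times> carrier U)" and ?N = "tensor_null V U"
  note F = complex_space_free_space[of "carrier V \<times> carrier U"]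
  note N = tensor_null[OF V U]
  define h where "h k c = Poly_Mapping.single (map_prod f g k) c" for k and c :: complex
  define L where "L t = (\<Sum>k\<in>Poly_Mapping.keys t. h k (Poly_Mapping.lookup t k))" for t
  have add: "L (s + t) = L s + L t" for s t
    unfolding L_def by (rule setsum_keys_plus_distrib) (auto simp: h_def Poly_Mapping.single_add)
  have single: "L (Poly_Mapping.single k c) = h k c" for k c
    by (auto simp: L_def h_def)
  have diff: "L (s - t) = L s - L t" for s t
    using add[of "s - t" t] by simp
  interpret F: Module.module complex_field ?F by (rule F)
  have closed: "L t \<in> carrier ?F \<and> L (Poly_Mapping.map ((*) c) t) = Poly_Mapping.map ((*) c) (L t)"
    if "t \<in> carrier ?F" for t c
  proof -
    have "Poly_Mapping.keys t \<subseteq> carrier V \<times> carrier U" using that by (simp add: free_space_def)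
    then show ?thesis
    proof (induction t rule: poly_mapping_single_induct)
      case zero
      have "Poly_Mapping.map ((*) c) 0 = (0 :: 'a \<times> 'c \<Rightarrow>\<^sub>0 complex)"
        by (rule poly_mapping_eqI) (simp add: lookup_scale)
      then show ?case by (simp add: L_def free_space_def)
    next
      case (add k d t)
      have "h k d \<in> carrier ?F"
        using add(1) linear_mapD(1)[OF f] linear_mapD(1)[OF g]
        unfolding h_def by (intro basis_vec_carrier) auto
      moreover have "Poly_Mapping.map ((*) c) (x + y) =
          Poly_Mapping.map ((*) c) x + Poly_Mapping.map ((*) c) y" for x y :: "'a \<times> 'c \<Rightarrow>\<^sub>0 complex"
        by (rule poly_mapping_eqI) (simp add: lookup_scale lookup_add distrib_left)
      ultimately show ?case
        using add F.add.m_closed[of "h k d" "L t"] \<open>\<And>s t. L (s + t) = L s + L t\<close>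
        by (auto simp: single free_space_simps scale_single h_def)
    qed
  qed
  have lin: "linear_map ?F ?F L"
    unfolding linear_map_def using closed by (auto simp: free_space_simps add)
  have "L r \<in> ?N" if "r \<in> tensor_relations V U" for r
  proof -
    have "L r \<in> tensor_relations V U"
      using that[unfolded tensor_relations_def]
      by (elim UnE CollectE exE conjE)
         (simp_all add: diff single h_def linear_mapD[OF f] linear_mapD[OF g] tensor_relationsI)
    then show ?thesis using N(2) by blast
  qed
  then have "L ` ?N \<subseteq> ?N"
    unfolding tensor_null_def
    using linear_map_lin_span[OF F F lin N(1) tensor_relations_carrier[OF V U]]
    unfolding tensor_null_def by blast
  then have "quot_map ?F ?N L (?N +>\<^bsub>?F\<^esub> basis_vec (v, u)) = ?N +>\<^bsub>?F\<^esub> L (basis_vec (v, u))"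
    using linear_mapD[OF lin] v u
    by (intro quot_map_coset[OF F N(1)] basis_vec_carrier) auto
  moreover have "L = (\<lambda>t. \<Sum>k\<in>Poly_Mapping.keys t.
      Poly_Mapping.single (map_prod f g k) (Poly_Mapping.lookup t k))"
    by (rule ext) (simp add: L_def h_def)
  ultimately show ?thesis
    unfolding tensor_map_def pure_tensor_def by (simp add: single h_def)
qed

section \<open>Algebras given by generators and relations\<close>

lemma scale_eq_const_elem_mult:
  "Poly_Mapping.map ((*) c) t = const_elem c * t" for t :: "'x word \<Rightarrow>\<^sub>0 complex"
  by (rule mult_map_scale_conv_mult)

lemma free_algebra_simps:
  "x \<oplus>\<^bsub>free_algebra X\<^esub> y = x + y" "\<zero>\<^bsub>free_algebra X\<^esub> = 0" "\<one>\<^bsub>free_algebra X\<^esub> = 1"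
  "x \<otimes>\<^bsub>free_algebra X\<^esub> y = x * y" "c \<odot>\<^bsub>free_algebra X\<^esub> x = const_elem c * x"
  by (simp_all add: free_algebra_def scale_eq_const_elem_mult)

lemma free_algebra_carrier_iff:
  "t \<in> carrier (free_algebra X) \<longleftrightarrow> Poly_Mapping.keys t \<subseteq> {w. set (letters w) \<subseteq> X}"
  by (auto simp: free_algebra_def)

lemma free_algebra_closed:
  "0 \<in> carrier (free_algebra X)" "1 \<in> carrier (free_algebra X)" "const_elem c \<in> carrier (free_algebra X)"
  "set (letters w) \<subseteq> X \<Longrightarrow> Poly_Mapping.single w c \<in> carrier (free_algebra X)"
  "s \<in> carrier (free_algebra X) \<Longrightarrow> t \<in> carrier (free_algebra X) \<Longrightarrow> s + t \<in> carrier (free_algebra X)"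
  "s \<in> carrier (free_algebra X) \<Longrightarrow> t \<in> carrier (free_algebra X) \<Longrightarrow> s - t \<in> carrier (free_algebra X)"
  "s \<in> carrier (free_algebra X) \<Longrightarrow> t \<in> carrier (free_algebra X) \<Longrightarrow> s * t \<in> carrier (free_algebra X)"
proof -
  assume s: "s \<in> carrier (free_algebra X)" and t: "t \<in> carrier (free_algebra X)"
  show "s + t \<in> carrier (free_algebra X)" "s - t \<in> carrier (free_algebra X)"
    using s t Poly_Mapping.keys_add[of s t] Poly_Mapping.keys_add[of s "- t"]
    by (auto simp: free_algebra_carrier_iff)
  show "s * t \<in> carrier (free_algebra X)"
  proof -
    have "set (letters (a + b)) \<subseteq> X" if "a \<in> Poly_Mapping.keys s" "b \<in> Poly_Mapping.keys t" for a b
      using s t that by (auto simp: free_algebra_def plus_word_def)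
    then show ?thesis using Poly_Mapping.keys_mult[of s t] unfolding free_algebra_carrier_iff by blast
  qed
qed (simp_all add: free_algebra_carrier_iff zero_word_def flip: single_one)

lemma complex_space_free_algebra: "complex_space (free_algebra X)"
proof (rule complex_spaceI)
  show "abelian_group (free_algebra X)"
  proof (rule abelian_groupI)
    fix x assume "x \<in> carrier (free_algebra X)"
    then show "\<exists>y\<in>carrier (free_algebra X). y \<oplus>\<^bsub>free_algebra X\<^esub> x = \<zero>\<^bsub>free_algebra X\<^esub>"
      by (intro bexI[of _ "- x"]) (auto simp: free_algebra_carrier_iff free_algebra_simps)
  qed (auto simp: free_algebra_simps free_algebra_closed add.commute add.left_commute)
next
  fix a b :: complex and x :: "'a word \<Rightarrow>\<^sub>0 complex"
  have "const_elem (a * b) * x = const_elem a * (const_elem b * x)"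
    by (simp add: mult_single flip: mult.assoc)
  then show "(a * b) \<odot>\<^bsub>free_algebra X\<^esub> x = a \<odot>\<^bsub>free_algebra X\<^esub> (b \<odot>\<^bsub>free_algebra X\<^esub> x)"
    by (simp add: free_algebra_simps)
qed (simp_all add: free_algebra_simps free_algebra_closed single_add distrib_left distrib_right)

lemma ring_free_algebra: "ring (free_algebra X)"
proof (rule ringI)
  interpret Module.module complex_field "free_algebra X" by (rule complex_space_free_algebra)
  show "abelian_group (free_algebra X)" by (rule abelian_group_axioms)
  show "Group.monoid (free_algebra X)"
    by (rule monoidI) (auto simp: free_algebra_simps free_algebra_closed mult.assoc)
qed (simp_all add: free_algebra_simps distrib_left distrib_right)

definition presented_class ::
    "'x set \<Rightarrow> ('x word \<Rightarrow>\<^sub>0 complex) set \<Rightarrow> ('x word \<Rightarrow>\<^sub>0 complex) \<Rightarrow> ('x word \<Rightarrow>\<^sub>0 complex) set" where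
  "presented_class X Rel t = (Idl\<^bsub>free_algebra X\<^esub> Rel) +>\<^bsub>free_algebra X\<^esub> t"

lemma presented_gen_eq: "presented_gen X Rel x = presented_class X Rel (gen x)"
  by (simp add: presented_gen_def presented_class_def)

context
  fixes X :: "'x set" and Rel :: "('x word \<Rightarrow>\<^sub>0 complex) set"
  assumes Rel: "Rel \<subseteq> carrier (free_algebra X)"
begin

interpretation F: ring "free_algebra X" by (rule ring_free_algebra)
interpretation I: ideal "Idl\<^bsub>free_algebra X\<^esub> Rel" "free_algebra X"
  by (rule F.genideal_ideal[OF Rel])

lemma complex_subspace_Idl: "complex_subspace (Idl\<^bsub>free_algebra X\<^esub> Rel) (free_algebra X)"
proof (rule complex_subspaceI[OF complex_space_free_algebra])
  fix c x assume "x \<in> Idl\<^bsub>free_algebra X\<^esub> Rel"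
  from I.I_l_closed[OF this free_algebra_closed(3)]
  show "c \<odot>\<^bsub>free_algebra X\<^esub> x \<in> Idl\<^bsub>free_algebra X\<^esub> Rel"
    by (simp only: free_algebra_simps)
qed (use I.a_subset I.a_closed I.zero_closed in blast)+

lemma complex_space_presented: "complex_space (presented X Rel)"
  unfolding presented_def
  by (intro complex_space_quot_space complex_space_free_algebra complex_subspace_Idl)

lemma presented_class:
  shows "carrier (presented X Rel) = presented_class X Rel ` carrier (free_algebra X)"
    and "\<one>\<^bsub>presented X Rel\<^esub> = presented_class X Rel 1"
    and "s \<in> carrier (free_algebra X) \<Longrightarrow> t \<in> carrier (free_algebra X) \<Longrightarrow>
      presented_class X Rel s \<oplus>\<^bsub>presented X Rel\<^esub> presented_class X Rel t = presented_class X Rel (s + t)"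
    and "s \<in> carrier (free_algebra X) \<Longrightarrow> t \<in> carrier (free_algebra X) \<Longrightarrow>
      presented_class X Rel s \<otimes>\<^bsub>presented X Rel\<^esub> presented_class X Rel t = presented_class X Rel (s * t)"
    and "t \<in> carrier (free_algebra X) \<Longrightarrow>
      c \<odot>\<^bsub>presented X Rel\<^esub> presented_class X Rel t = presented_class X Rel (const_elem c * t)"
    and "t \<in> carrier (free_algebra X) \<Longrightarrow> t \<in> presented_class X Rel t"
proof -
  note F = complex_space_free_algebra[of X] and I = complex_subspace_Idl
  show "carrier (presented X Rel) = presented_class X Rel ` carrier (free_algebra X)"
    and "\<one>\<^bsub>presented X Rel\<^esub> = presented_class X Rel 1"
    by (simp_all add: presented_def presented_class_def[abs_def] carrier_quot_space quot_space_simps(4)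
        free_algebra_simps)
  show "presented_class X Rel s \<oplus>\<^bsub>presented X Rel\<^esub> presented_class X Rel t = presented_class X Rel (s + t)"
    if "s \<in> carrier (free_algebra X)" "t \<in> carrier (free_algebra X)"
    using coset_add[OF F I that] by (simp add: presented_def presented_class_def free_algebra_simps)
  show "presented_class X Rel s \<otimes>\<^bsub>presented X Rel\<^esub> presented_class X Rel t = presented_class X Rel (s * t)"
    if "s \<in> carrier (free_algebra X)" "t \<in> carrier (free_algebra X)"
    using I.rcoset_mult_add[OF that]
    by (simp add: presented_def presented_class_def free_algebra_simps quot_space_simps)
  show "c \<odot>\<^bsub>presented X Rel\<^esub> presented_class X Rel t = presented_class X Rel (const_elem c * t)"
    if "t \<in> carrier (free_algebra X)"
    using coset_smult[OF F I that] by (simp add: presented_def presented_class_def free_algebra_simps)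
  show "t \<in> presented_class X Rel t" if "t \<in> carrier (free_algebra X)"
    unfolding presented_class_def by (rule I.a_rcos_self[OF that])
qed

lemma presented_class_representative:
  assumes "u \<in> carrier (presented X Rel)" "t \<in> u"
  shows "t \<in> carrier (free_algebra X)" "u = presented_class X Rel t"
proof -
  obtain s where s: "s \<in> carrier (free_algebra X)" and u: "u = presented_class X Rel s"
    using assms(1) by (auto simp: presented_class)
  have t: "t \<in> (Idl\<^bsub>free_algebra X\<^esub> Rel) +>\<^bsub>free_algebra X\<^esub> s"
    using assms(2) by (simp add: u presented_class_def)
  show "t \<in> carrier (free_algebra X)" by (rule I.a_elemrcos_carrier[OF s t])
  show "u = presented_class X Rel t"
    using I.a_repr_independence'[OF t s] by (simp add: u presented_class_def)
qed

lemma ring_presented: "ring (presented X Rel)"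
proof (rule ringI)
  interpret P: Module.module complex_field "presented X Rel" by (rule complex_space_presented)
  show "abelian_group (presented X Rel)" by (rule P.abelian_group_axioms)
  show "Group.monoid (presented X Rel)"
    by (rule monoidI) (auto simp: presented_class free_algebra_closed mult.assoc)
qed (auto simp: presented_class free_algebra_closed distrib_left distrib_right)

lemma presented_smult_assoc:
  assumes "a \<in> carrier (presented X Rel)" "b \<in> carrier (presented X Rel)"
  shows "(c \<odot>\<^bsub>presented X Rel\<^esub> a) \<otimes>\<^bsub>presented X Rel\<^esub> b =
    c \<odot>\<^bsub>presented X Rel\<^esub> (a \<otimes>\<^bsub>presented X Rel\<^esub> b)"
  using assms by (auto simp: presented_class free_algebra_closed mult.assoc)

end

text \<open>
  If some relator lies outside the free algebra, then no ideal contains all relators, and the ideal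
  that they generate, being the intersection of an empty family, is the whole type.  The quotient then
  has a single element, and a unital linear map out of it forces \<open>1 = 0\<close> in the target.  For the
  enveloping algebra of \<open>\<gg>\<close>, the conclusion says that \<open>\<gg>\<close> is closed under sums, scalar multiples and
  brackets; the canonical homomorphism into the Weyl algebra thus yields it without any Lie theory.
\<close>

lemma relations_closed_of_hom:
  assumes A: "complex_space A" and nz: "\<one>\<^bsub>A\<^esub> \<noteq> \<zero>\<^bsub>A\<^esub>"
    and hom: "f \<in> ring_hom (presented X Rel) A" and lin: "linear_map (presented X Rel) A f"
  shows "Rel \<subseteq> carrier (free_algebra X)"
proof (rule ccontr)
  assume "\<not> Rel \<subseteq> carrier (free_algebra X)"
  then have "\<not> (ideal I (free_algebra X) \<and> Rel \<subseteq> I)" for I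
    using additive_subgroup.a_subset[OF ideal.axioms(1)] by blast
  then have Idl: "Idl\<^bsub>free_algebra X\<^esub> Rel = UNIV" by (auto simp: genideal_def)
  have coset: "UNIV +>\<^bsub>free_algebra X\<^esub> t = UNIV" for t
  proof -
    have "y = (y - t) + t" for y by simp
    then show ?thesis unfolding a_r_coset_def' free_algebra_simps by blast
  qed
  have car: "UNIV \<in> carrier (presented X Rel)"
    using free_algebra_closed(1) by (auto simp: presented_def Idl carrier_quot_space coset)
  have "f (0 \<odot>\<^bsub>presented X Rel\<^esub> UNIV) = f \<one>\<^bsub>presented X Rel\<^esub>"
    by (simp add: presented_def Idl quot_space_simps coset quot_map_def)
  then have "0 \<odot>\<^bsub>A\<^esub> f UNIV = \<one>\<^bsub>A\<^esub>"
    using linear_mapD(3)[OF lin car] ring_hom_one[OF hom] by simp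
  then show False
    using complex_space_smult_0[OF A linear_mapD(1)[OF lin car]] nz by simp
qed

section \<open>Unital algebras acting on a space\<close>

locale algebra_action =
  fixes A :: "(complex, 'a, 'z) module_scheme" and M :: "(complex, 'm, 'y) module_scheme"
    and act :: "'a \<Rightarrow> 'm \<Rightarrow> 'm"
  assumes ring: "ring A" and A: "complex_space A" and M: "complex_space M"
    and act_closed: "a \<in> carrier A \<Longrightarrow> x \<in> carrier M \<Longrightarrow> act a x \<in> carrier M"
    and act_add: "a \<in> carrier A \<Longrightarrow> b \<in> carrier A \<Longrightarrow> x \<in> carrier M \<Longrightarrow>
      act (a \<oplus>\<^bsub>A\<^esub> b) x = act a x \<oplus>\<^bsub>M\<^esub> act b x"
    and act_smult: "a \<in> carrier A \<Longrightarrow> x \<in> carrier M \<Longrightarrow> act (c \<odot>\<^bsub>A\<^esub> a) x = c \<odot>\<^bsub>M\<^esub> act a x"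
    and act_mult: "a \<in> carrier A \<Longrightarrow> b \<in> carrier A \<Longrightarrow> x \<in> carrier M \<Longrightarrow>
      act (a \<otimes>\<^bsub>A\<^esub> b) x = act a (act b x)"
    and act_one: "x \<in> carrier M \<Longrightarrow> act \<one>\<^bsub>A\<^esub> x = x"
    and act_add_right: "a \<in> carrier A \<Longrightarrow> x \<in> carrier M \<Longrightarrow> y \<in> carrier M \<Longrightarrow>
      act a (x \<oplus>\<^bsub>M\<^esub> y) = act a x \<oplus>\<^bsub>M\<^esub> act a y"

lemma foldr_closed:
  assumes "\<And>x. x \<in> X \<Longrightarrow> linear_map V V (xv x)" "v \<in> carrier V" "set xs \<subseteq> X"
  shows "foldr xv xs v \<in> carrier V"
  using assms(3) by (induction xs) (use assms linear_mapD(1) in fastforce)+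

lemma free_act_zero: "free_act V xv 0 v = \<zero>\<^bsub>V\<^esub>" if "complex_space V"
proof -
  interpret V: Module.module complex_field V by fact
  show ?thesis by (simp add: free_act_def)
qed

lemma free_act_single_add:
  assumes V: "complex_space V" and xv: "\<And>x. x \<in> X \<Longrightarrow> linear_map V V (xv x)" and v: "v \<in> carrier V"
    and k: "set (letters k) \<subseteq> X" "k \<notin> Poly_Mapping.keys t" "c \<noteq> 0"
    and t: "t \<in> carrier (free_algebra X)"
  shows "free_act V xv (Poly_Mapping.single k c + t) v =
      c \<odot>\<^bsub>V\<^esub> foldr xv (letters k) v \<oplus>\<^bsub>V\<^esub> free_act V xv t v"
proof -
  interpret V: Module.module complex_field V by fact
  note closed = foldr_closed[of X V xv v, OF xv v] V.smult_closed[simplified]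
  let ?s = "Poly_Mapping.single k c + t"
  let ?term = "\<lambda>r w. Poly_Mapping.lookup r w \<odot>\<^bsub>V\<^esub> foldr xv (letters w) v"
  have cl: "?term r w \<in> carrier V" if "w \<in> insert k (Poly_Mapping.keys t)" for r w
    using that k t closed by (auto simp: free_algebra_def)
  have keys: "Poly_Mapping.keys ?s = insert k (Poly_Mapping.keys t)"
    using k by (auto simp: Poly_Mapping.in_keys_iff lookup_add lookup_single when_def set_eq_iff)
  have look: "Poly_Mapping.lookup ?s k = c"
    using k by (simp add: lookup_add Poly_Mapping.in_keys_iff)
  have "free_act V xv ?s v = ?term ?s k \<oplus>\<^bsub>V\<^esub> finsum V (?term ?s) (Poly_Mapping.keys t)"
    unfolding free_act_def keys using cl k by (intro V.finsum_insert) auto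
  also have "finsum V (?term ?s) (Poly_Mapping.keys t) = finsum V (?term t) (Poly_Mapping.keys t)"
    using cl k by (intro V.finsum_cong') (auto simp: lookup_add lookup_single when_def)
  finally show "free_act V xv ?s v = c \<odot>\<^bsub>V\<^esub> foldr xv (letters k) v \<oplus>\<^bsub>V\<^esub> free_act V xv t v"
    by (simp add: look free_act_def)
qed

lemma free_act_closed:
  assumes V: "complex_space V" and xv: "\<And>x. x \<in> X \<Longrightarrow> linear_map V V (xv x)" and v: "v \<in> carrier V"
    and t: "t \<in> carrier (free_algebra X)"
  shows "free_act V xv t v \<in> carrier V"
proof -
  interpret V: Module.module complex_field V by fact
  show ?thesis
    unfolding free_act_def
    using foldr_closed[of X V xv v, OF xv v] t V.smult_closed[simplified]
    by (intro V.finsum_closed) (auto simp: free_algebra_def)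
qed

context algebra_action
begin

text \<open>
  Passing from generators to the algebra, in a form that fits one pure tensor: in the application \<open>j\<close>
  is \<open>v \<mapsto> v \<otimes> u\<close> for fixed \<open>u\<close>, or \<open>u \<mapsto> v \<otimes> u\<close> for fixed \<open>v\<close>.  The
  hypothesis on generators is about arbitrary \<open>y\<close> and \<open>v\<close> with \<open>q y = j v\<close>, so it can be iterated
  along a word; linearity in \<open>t\<close> then gives the general case.
\<close>

lemma intertwining_extends:
  assumes Rel: "Rel \<subseteq> carrier (free_algebra X)"
    and hom: "f \<in> ring_hom (presented X Rel) A" and lin: "linear_map (presented X Rel) A f"
    and V: "complex_space V" and xv: "\<And>x. x \<in> X \<Longrightarrow> linear_map V V (xv x)"
    and q: "linear_map M T q" and j: "linear_map V T j"
    and gens: "\<And>x y v. x \<in> X \<Longrightarrow> y \<in> carrier M \<Longrightarrow> v \<in> carrier V \<Longrightarrow> q y = j v \<Longrightarrow>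
      q (act (f (presented_gen X Rel x)) y) = j (xv x v)"
    and t: "t \<in> carrier (free_algebra X)" and y: "y \<in> carrier M" and v: "v \<in> carrier V"
    and eq: "q y = j v"
  shows "q (act (f (presented_class X Rel t)) y) = j (free_act V xv t v)"
proof -
  interpret M: Module.module complex_field M by (rule M)
  interpret V: Module.module complex_field V by fact
  interpret P: Module.module complex_field "presented X Rel" by (rule complex_space_presented[OF Rel])
  note cls = presented_class[OF Rel]
  have fc: "f (presented_class X Rel t) \<in> carrier A" if "t \<in> carrier (free_algebra X)" for t
    using linear_mapD(1)[OF lin] that by (auto simp: cls)
  have mc: "act (f (presented_class X Rel t)) y \<in> carrier M" if "t \<in> carrier (free_algebra X)" for t
    using act_closed fc that y by auto
  have word: "q (act (f (presented_class X Rel (Poly_Mapping.single (Word xs) 1))) y) = j (foldr xv xs v)"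
    if "set xs \<subseteq> X" for xs
    using that
  proof (induction xs)
    case Nil
    have "(Poly_Mapping.single (Word []) 1 :: 'b word \<Rightarrow>\<^sub>0 complex) = 1"
      by (simp flip: zero_word_def)
    then show ?case
      using eq act_one[OF y] ring_hom_one[OF hom] by (simp add: cls)
  next
    case (Cons x xs)
    let ?w = "Poly_Mapping.single (Word xs) 1 :: 'b word \<Rightarrow>\<^sub>0 complex"
    have c: "gen x \<in> carrier (free_algebra X)" "?w \<in> carrier (free_algebra X)"
      using Cons.prems by (auto intro!: free_algebra_closed)
    have "Poly_Mapping.single (Word (x # xs)) 1 = gen x * ?w"
      by (simp add: mult_single plus_word_def)
    then have "f (presented_class X Rel (Poly_Mapping.single (Word (x # xs)) 1)) =
        f (presented_gen X Rel x) \<otimes>\<^bsub>A\<^esub> f (presented_class X Rel ?w)"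
      using ring_hom_mult[OF hom, of "presented_class X Rel (gen x)" "presented_class X Rel ?w"] c
      by (simp add: cls presented_gen_eq)
    then have "act (f (presented_class X Rel (Poly_Mapping.single (Word (x # xs)) 1))) y =
        act (f (presented_gen X Rel x)) (act (f (presented_class X Rel ?w)) y)"
      using act_mult fc c y by (simp add: presented_gen_eq)
    then show ?case
      using gens Cons mc[OF c(2)] foldr_closed[of X V xv v, OF xv v] by simp
  qed
  have "Poly_Mapping.keys t \<subseteq> {w. set (letters w) \<subseteq> X}"
    using t by (simp add: free_algebra_carrier_iff)
  then show ?thesis
  proof (induction t rule: poly_mapping_single_induct)
    case zero
    have "const_elem 0 * (0 :: 'b word \<Rightarrow>\<^sub>0 complex) = 0" by simp
    then have "f (presented_class X Rel 0) = 0 \<odot>\<^bsub>A\<^esub> f (presented_class X Rel 0)"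
      using linear_mapD(3)[OF lin, of "presented_class X Rel 0" 0] free_algebra_closed(1)[of X]
      by (simp add: cls)
    then have "act (f (presented_class X Rel 0)) y = \<zero>\<^bsub>M\<^esub>"
      using act_smult[OF fc[OF free_algebra_closed(1)] y, of 0]
        complex_space_smult_0[OF M mc[OF free_algebra_closed(1)]] by simp
    then have "q (act (f (presented_class X Rel 0)) y) = q (0 \<odot>\<^bsub>M\<^esub> y)"
      using complex_space_smult_0[OF M y] by simp
    also have "\<dots> = j (0 \<odot>\<^bsub>V\<^esub> v)"
      using linear_mapD(3)[OF q y] linear_mapD(3)[OF j v] eq by simp
    finally show ?case using complex_space_smult_0[OF V v] by (simp add: free_act_zero[OF V])
  next
    case (add k c t)
    have k: "set (letters k) \<subseteq> X" using add(1) by simp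
    have t: "t \<in> carrier (free_algebra X)" using add(2) by (simp add: free_algebra_carrier_iff)
    let ?k = "Poly_Mapping.single k 1 :: 'b word \<Rightarrow>\<^sub>0 complex"
    have kc: "?k \<in> carrier (free_algebra X)" "Poly_Mapping.single k c \<in> carrier (free_algebra X)"
      using k by (auto intro: free_algebra_closed)
    have "presented_class X Rel (Poly_Mapping.single k c + t) =
        c \<odot>\<^bsub>presented X Rel\<^esub> presented_class X Rel ?k \<oplus>\<^bsub>presented X Rel\<^esub> presented_class X Rel t"
      using kc t by (simp add: cls mult_single)
    moreover have "presented_class X Rel ?k \<in> carrier (presented X Rel)"
        "presented_class X Rel t \<in> carrier (presented X Rel)"
      using kc t by (auto simp: cls(1))
    ultimately have "f (presented_class X Rel (Poly_Mapping.single k c + t)) =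
        c \<odot>\<^bsub>A\<^esub> f (presented_class X Rel ?k) \<oplus>\<^bsub>A\<^esub> f (presented_class X Rel t)"
      using linear_mapD[OF lin] P.smult_closed by simp
    moreover have "c \<odot>\<^bsub>A\<^esub> f (presented_class X Rel ?k) \<in> carrier A"
      using fc[OF kc(1)] Module.module.smult_closed[OF A] by simp
    ultimately have "act (f (presented_class X Rel (Poly_Mapping.single k c + t))) y =
        c \<odot>\<^bsub>M\<^esub> act (f (presented_class X Rel ?k)) y \<oplus>\<^bsub>M\<^esub> act (f (presented_class X Rel t)) y"
      using act_add act_smult fc kc t y by simp
    also have "q \<dots> = c \<odot>\<^bsub>T\<^esub> q (act (f (presented_class X Rel ?k)) y) \<oplus>\<^bsub>T\<^esub>
        q (act (f (presented_class X Rel t)) y)"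
      using linear_mapD[OF q] mc kc t M.smult_closed[simplified] by simp
    also have "q (act (f (presented_class X Rel ?k)) y) = j (foldr xv (letters k) v)"
      using word[OF k] by simp
    also have "c \<odot>\<^bsub>T\<^esub> j (foldr xv (letters k) v) \<oplus>\<^bsub>T\<^esub> q (act (f (presented_class X Rel t)) y) =
        j (c \<odot>\<^bsub>V\<^esub> foldr xv (letters k) v \<oplus>\<^bsub>V\<^esub> free_act V xv t v)"
      using linear_mapD[OF j] foldr_closed[of X V xv v, OF xv v k] free_act_closed[OF V xv v t] add
        V.smult_closed[simplified] by simp
    also have "\<dots> = j (free_act V xv (Poly_Mapping.single k c + t) v)"
      using free_act_single_add[OF V xv v k add(3,4) t] by simp
    finally show ?case .
  qed
qed

end

section \<open>The quotient by a left ideal\<close>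

lemma quotient_action:
  assumes ring: "ring A" and A: "complex_space A" and N: "complex_subspace N A"
    and assoc: "\<And>c a b. a \<in> carrier A \<Longrightarrow> b \<in> carrier A \<Longrightarrow>
      (c \<odot>\<^bsub>A\<^esub> a) \<otimes>\<^bsub>A\<^esub> b = c \<odot>\<^bsub>A\<^esub> (a \<otimes>\<^bsub>A\<^esub> b)"
    and ideal: "\<And>a x. a \<in> carrier A \<Longrightarrow> x \<in> N \<Longrightarrow> a \<otimes>\<^bsub>A\<^esub> x \<in> N"
  shows "algebra_action A (quot_space A N) (\<lambda>a. quot_map A N (\<lambda>x. a \<otimes>\<^bsub>A\<^esub> x))"
proof -
  interpret A: ring A by fact
  interpret AM: Module.module complex_field A by fact
  have act: "quot_map A N (\<lambda>x. a \<otimes>\<^bsub>A\<^esub> x) (N +>\<^bsub>A\<^esub> y) = N +>\<^bsub>A\<^esub> (a \<otimes>\<^bsub>A\<^esub> y)"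
    if "a \<in> carrier A" "y \<in> carrier A" for a y
    using that ideal by (intro quot_map_coset[OF A N]) (auto simp: A.r_distr)
  show ?thesis
  proof (rule algebra_action.intro[OF ring A complex_space_quot_space[OF A N]])
  qed (auto simp: act assoc carrier_quot_space coset_add[OF A N] coset_smult[OF A N]
      A.l_distr A.r_distr A.m_assoc AM.smult_closed[simplified])
qed

lemma algebra_action_cong:
  assumes "algebra_action A M act" "complex_space M'"
    and eq: "carrier M' = carrier M" "add M' = add M" "Module.smult M' = Module.smult M"
  shows "algebra_action A M' act"
proof -
  interpret algebra_action A M act by fact
  show ?thesis
    by (rule algebra_action.intro; (simp only: eq)?)
       (rule ring A assms(2) act_closed act_add act_smult act_mult act_one act_add_right; assumption)+
qed

lemma generated_left_ideal:
  assumes ring: "ring A" and A: "complex_space A" and S: "S \<subseteq> carrier A"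
    and assoc: "\<And>c a b. a \<in> carrier A \<Longrightarrow> b \<in> carrier A \<Longrightarrow>
      (c \<odot>\<^bsub>A\<^esub> a) \<otimes>\<^bsub>A\<^esub> b = c \<odot>\<^bsub>A\<^esub> (a \<otimes>\<^bsub>A\<^esub> b)"
  shows "complex_subspace (generated_left_ideal A S) A"
    and "a \<in> carrier A \<Longrightarrow> x \<in> generated_left_ideal A S \<Longrightarrow> a \<otimes>\<^bsub>A\<^esub> x \<in> generated_left_ideal A S"
proof -
  interpret A: ring A by fact
  interpret AM: Module.module complex_field A by fact
  show "complex_subspace (generated_left_ideal A S) A"
    unfolding generated_left_ideal_def
  proof (rule complex_subspace_Inter[OF A])
    show "{I. subgroup I (add_monoid A) \<and> (\<forall>a\<in>carrier A. \<forall>x\<in>I. a \<otimes>\<^bsub>A\<^esub> x \<in> I) \<and> S \<subseteq> I} \<noteq> {}"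
      using S AM.carrier_is_submodule by (auto simp: submodule_def)
  next
    fix N assume "N \<in> {I. subgroup I (add_monoid A) \<and> (\<forall>a\<in>carrier A. \<forall>x\<in>I. a \<otimes>\<^bsub>A\<^esub> x \<in> I) \<and> S \<subseteq> I}"
    then have sub: "subgroup N (add_monoid A)" and ideal: "\<And>a x. a \<in> carrier A \<Longrightarrow> x \<in> N \<Longrightarrow> a \<otimes>\<^bsub>A\<^esub> x \<in> N"
      by auto
    have smult: "c \<odot>\<^bsub>A\<^esub> x \<in> N" if "x \<in> N" for c x
    proof -
      have x: "x \<in> carrier A" using subgroup.subset[OF sub] that by auto
      then have "c \<odot>\<^bsub>A\<^esub> x = (c \<odot>\<^bsub>A\<^esub> \<one>\<^bsub>A\<^esub>) \<otimes>\<^bsub>A\<^esub> x" by (simp add: assoc)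
      then show ?thesis using ideal[OF _ that, of "c \<odot>\<^bsub>A\<^esub> \<one>\<^bsub>A\<^esub>"] by simp
    qed
    show "complex_subspace N A"
      by (rule complex_subspaceI[OF A])
         (use subgroup.subset[OF sub] subgroup.one_closed[OF sub] subgroup.m_closed[OF sub] smult in auto)
  qed
qed (auto simp: generated_left_ideal_def)

lemma (in algebra_action) one_not_zero:
  assumes x: "x \<in> carrier M" "x \<noteq> \<zero>\<^bsub>M\<^esub>"
  shows "\<one>\<^bsub>A\<^esub> \<noteq> \<zero>\<^bsub>A\<^esub>"
proof
  interpret AR: ring A by (rule ring)
  assume "\<one>\<^bsub>A\<^esub> = \<zero>\<^bsub>A\<^esub>"
  then have "x = act (0 \<odot>\<^bsub>A\<^esub> \<one>\<^bsub>A\<^esub>) x"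
    using act_one[OF x(1)] complex_space_smult_0[OF A AR.one_closed] by simp
  also have "\<dots> = 0 \<odot>\<^bsub>M\<^esub> x" using act_smult[OF AR.one_closed x(1)] act_one[OF x(1)] by simp
  finally show False using complex_space_smult_0[OF M x(1)] x(2) by simp
qed

section \<open>Transfer of annihilators\<close>

text \<open>
  The abstract form of the theorem.  Let \<open>J\<close> be the set of \<open>b\<close> in \<open>A\<close> with \<open>q (b M) = 0\<close>.  It is a right
  ideal, because \<open>M\<close> is stable under \<open>A\<close>: \<open>q (b (c y)) = 0\<close>.  It contains \<open>L b\<close> for each \<open>b\<close> in \<open>I'\<close>,
  since \<open>L b\<close> acts on \<open>V \<otimes> U\<close> through the second factor, where it is zero.  So \<open>J\<close> contains \<open>R a\<close>, while
  \<open>R a\<close> acts on \<open>V \<otimes> U\<close> through the first factor; testing on \<open>v \<otimes> u\<close> with a fixed \<open>u \<noteq> 0\<close> gives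
  \<open>a v = 0\<close>.
\<close>

lemma (in algebra_action) right_ideal_annihilates:
  assumes V: "complex_space V" and U: "complex_space U"
    and Rel: "Rel \<subseteq> carrier (free_algebra X)" and Rel': "Rel' \<subseteq> carrier (free_algebra X')"
    and R: "R \<in> ring_hom (presented X Rel) A" "linear_map (presented X Rel) A R"
    and L: "L \<in> ring_hom (presented X' Rel') A" "linear_map (presented X' Rel') A L"
    and xv: "\<And>x. x \<in> X \<Longrightarrow> linear_map V V (xv x)"
    and xu: "\<And>x. x \<in> X' \<Longrightarrow> linear_map U U (xu x)"
    and q: "linear_map M (tensor V U) q" and surj: "carrier (tensor V U) \<subseteq> q ` carrier M"
    and R_gen: "\<And>x y v u. x \<in> X \<Longrightarrow> y \<in> carrier M \<Longrightarrow> v \<in> carrier V \<Longrightarrow> u \<in> carrier U \<Longrightarrow>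
      q y = pure_tensor V U v u \<Longrightarrow>
      q (act (R (presented_gen X Rel x)) y) = pure_tensor V U (xv x v) u"
    and L_gen: "\<And>x y v u. x \<in> X' \<Longrightarrow> y \<in> carrier M \<Longrightarrow> v \<in> carrier V \<Longrightarrow> u \<in> carrier U \<Longrightarrow>
      q y = pure_tensor V U v u \<Longrightarrow>
      q (act (L (presented_gen X' Rel' x)) y) = pure_tensor V U v (xu x u)"
    and I': "\<And>b. b \<in> I' \<Longrightarrow> b \<in> carrier (presented X' Rel') \<and>
      (\<forall>t\<in>b. \<forall>u\<in>carrier U. free_act U xu t u = \<zero>\<^bsub>U\<^esub>)"
    and U_nz: "carrier U \<noteq> {\<zero>\<^bsub>U\<^esub>}"
    and a: "a \<in> carrier (presented X Rel)" "R a \<in> generated_right_ideal A (L ` I')"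
    and t: "t \<in> a" and v: "v \<in> carrier V"
  shows "free_act V xv t v = \<zero>\<^bsub>V\<^esub>"
proof -
  let ?T = "tensor V U"
  interpret M: Module.module complex_field M by (rule M)
  interpret A: Module.module complex_field A by (rule A)
  interpret AR: ring A by (rule ring)
  interpret V: Module.module complex_field V by fact
  interpret U: Module.module complex_field U by fact
  note T_space = complex_space_tensor[OF V U]
  interpret T: Module.module complex_field ?T by (rule T_space)
  note pure = pure_tensor_linear[OF V U]
  have pure_zero: "pure_tensor V U v \<zero>\<^bsub>U\<^esub> = \<zero>\<^bsub>?T\<^esub>" if "v \<in> carrier V" for v
    using linear_map_zero[OF U T_space pure(2)[OF that]] .
  define J where "J = {b \<in> carrier A. \<forall>y\<in>carrier M. q (act b y) = \<zero>\<^bsub>?T\<^esub>}"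
  have "complex_subspace J A"
  proof (rule complex_subspaceI[OF A])
    have "act \<zero>\<^bsub>A\<^esub> y = \<zero>\<^bsub>M\<^esub>" if "y \<in> carrier M" for y
      using act_smult[OF A.zero_closed that, of 0] complex_space_smult_0[OF A A.zero_closed]
        complex_space_smult_0[OF M act_closed[OF A.zero_closed that]] by simp
    then show "\<zero>\<^bsub>A\<^esub> \<in> J" using linear_map_zero[OF M T_space q] by (simp add: J_def)
    show "b \<oplus>\<^bsub>A\<^esub> c \<in> J" if "b \<in> J" "c \<in> J" for b c
      using that linear_mapD(2)[OF q] by (auto simp: J_def act_add act_closed)
    show "c \<odot>\<^bsub>A\<^esub> b \<in> J" if "b \<in> J" for b c
      using that linear_mapD(3)[OF q] T.smult_r_null[of c] by (auto simp: J_def act_smult act_closed)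
  qed (auto simp: J_def)
  then have J_sub: "subgroup J (add_monoid A)" by (simp add: submodule_def)
  have J_ideal: "b \<otimes>\<^bsub>A\<^esub> c \<in> J" if "c \<in> carrier A" "b \<in> J" for b c
    using that by (auto simp: J_def act_mult act_closed)
  have L_J: "L b \<in> J" if b_I': "b \<in> I'" for b
  proof -
    have b: "b \<in> carrier (presented X' Rel')" using I'[OF b_I'] by simp
    then obtain s where s: "s \<in> carrier (free_algebra X')" "b = presented_class X' Rel' s"
      by (auto simp: presented_class(1)[OF Rel'])
    have s_b: "s \<in> b" using presented_class(6)[OF Rel' s(1)] s(2) by simp
    have Lb: "L b \<in> carrier A" using linear_mapD(1)[OF L(2) b] .
    have pure_case: "q (act (L b) y) = \<zero>\<^bsub>?T\<^esub>"
      if y: "y \<in> carrier M" and v: "v \<in> carrier V" and u: "u \<in> carrier U"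
        and eq: "q y = pure_tensor V U v u" for y v u
    proof -
      have "q (act (L b) y) = pure_tensor V U v (free_act U xu s u)"
        unfolding s(2)
        by (rule intertwining_extends[OF Rel' L U xu q pure(2)[OF v] L_gen s(1) y u eq])
           (use v in auto)
      also have "\<dots> = \<zero>\<^bsub>?T\<^esub>" using I'[OF b_I'] s_b u pure_zero[OF v] by auto
      finally show ?thesis .
    qed
    \<comment> \<open>The kernel of \<open>q\<close> is not visibly stable under \<open>L b\<close>, but its elements are those that \<open>q\<close> sends to
       the pure tensor \<open>0 \<otimes> 0\<close>; so \<open>y\<close> may be changed to a sum of preimages of pure tensors.\<close>
    have "\<forall>y\<in>carrier M. q y = z \<longrightarrow> q (act (L b) y) = \<zero>\<^bsub>?T\<^esub>" if "z \<in> carrier ?T" for z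
      using V U that
    proof (induction rule: tensor_induct)
      case zero
      show ?case using pure_case pure_zero[OF V.zero_closed] V.zero_closed U.zero_closed by metis
    next
      case (add v u z)
      show ?case
      proof (intro ballI impI)
        fix y assume y: "y \<in> carrier M" and qy: "q y = pure_tensor V U v u \<oplus>\<^bsub>?T\<^esub> z"
        obtain y' where y': "y' \<in> carrier M" "q y' = pure_tensor V U v u"
          using surj linear_mapD(1)[OF pure(2)[OF add(1)] add(2)] by (metis imageE subsetD)
        obtain y'' where y'': "y'' \<in> carrier M" "q y'' = z" using surj add(3) by (metis imageE subsetD)
        have sum: "y' \<oplus>\<^bsub>M\<^esub> y'' \<in> carrier M" "q (y' \<oplus>\<^bsub>M\<^esub> y'') = q y"
          using y' y'' qy linear_mapD(2)[OF q] by auto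
        define d where "d = y \<oplus>\<^bsub>M\<^esub> (-1) \<odot>\<^bsub>M\<^esub> (y' \<oplus>\<^bsub>M\<^esub> y'')"
        have neg: "(-1) \<odot>\<^bsub>M\<^esub> x \<oplus>\<^bsub>M\<^esub> x = \<zero>\<^bsub>M\<^esub>" if "x \<in> carrier M" for x
          using M.smult_l_distr[of "-1" 1 x] M.smult_one[of x] complex_space_smult_0[OF M that] that by simp
        have d: "d \<in> carrier M" "y = d \<oplus>\<^bsub>M\<^esub> (y' \<oplus>\<^bsub>M\<^esub> y'')"
          using y sum neg[OF sum(1)] by (simp_all add: d_def M.a_assoc)
        have "q d = q y \<oplus>\<^bsub>?T\<^esub> (-1) \<odot>\<^bsub>?T\<^esub> q y"
          unfolding d_def using y sum linear_mapD[OF q] by simp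
        also have "\<dots> = \<zero>\<^bsub>?T\<^esub>"
          using T.smult_l_distr[of 1 "-1" "q y"] T.smult_one[of "q y"] linear_mapD(1)[OF q y]
            complex_space_smult_0[OF T_space] by simp
        finally have "q d = pure_tensor V U \<zero>\<^bsub>V\<^esub> \<zero>\<^bsub>U\<^esub>" using pure_zero by simp
        then have "q (act (L b) d) = \<zero>\<^bsub>?T\<^esub>" using pure_case d(1) by blast
        moreover have "q (act (L b) y') = \<zero>\<^bsub>?T\<^esub>" using pure_case y' add by blast
        moreover have "q (act (L b) y'') = \<zero>\<^bsub>?T\<^esub>" using add y'' by blast
        ultimately show "q (act (L b) y) = \<zero>\<^bsub>?T\<^esub>"
          using d(1) y' y'' Lb linear_mapD(2)[OF q]
          by (subst d(2)) (simp add: act_add_right act_closed)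
      qed
    qed
    then show ?thesis using Lb linear_mapD(1)[OF q] by (auto simp: J_def)
  qed
  have "generated_right_ideal A (L ` I') \<subseteq> J"
    unfolding generated_right_ideal_def using J_sub J_ideal L_J by blast
  then have Ra: "q (act (R a) y) = \<zero>\<^bsub>?T\<^esub>" if "y \<in> carrier M" for y
    using a(2) that by (auto simp: J_def)
  obtain u where u: "u \<in> carrier U" "u \<noteq> \<zero>\<^bsub>U\<^esub>" using U_nz U.zero_closed by blast
  obtain y where y: "y \<in> carrier M" "q y = pure_tensor V U v u"
    using surj linear_mapD(1)[OF pure(2)[OF v] u(1)] by (metis imageE subsetD)
  note t' = presented_class_representative[OF Rel a(1) t]
  have "q (act (R a) y) = pure_tensor V U (free_act V xv t v) u"
    unfolding t'(2)
    by (rule intertwining_extends[OF Rel R V xv q pure(1)[OF u(1)] R_gen t'(1) y(1) v y(2)])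
       (use u in auto)
  then have "pure_tensor V U (free_act V xv t v) u = \<zero>\<^bsub>?T\<^esub>" using Ra[OF y(1)] by simp
  then show ?thesis
    using pure_tensor_eq_zeroD[OF V U free_act_closed[of V X xv, OF V xv v t'(1)] u(1) _ u(2)] by blast
qed

section \<open>Howe duality and transfer\<close>

lemma harish_chandra_moduleD:
  assumes "harish_chandra_module Mp p K G V"
  shows "complex_space V" "X \<in> complexified_lie G \<Longrightarrow> linear_map V V (lie_act V X)"
proof -
  note * = assms[unfolded harish_chandra_module_def Let_def]
  show "complex_space V" by (rule *[THEN conjunct1])
  show "linear_map V V (lie_act V X)" if "X \<in> complexified_lie G"
    by (rule bspec[OF *[THEN conjunct2, THEN conjunct1] that])
qed

lemma irreducible_admissibleD:
  assumes "irreducible_admissible Mp p K G V"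
  shows "complex_space V" "carrier V \<noteq> {\<zero>\<^bsub>V\<^esub>}"
    "X \<in> complexified_lie G \<Longrightarrow> linear_map V V (lie_act V X)"
proof -
  have hc: "harish_chandra_module Mp p K G V" and irr: "irreducible_hc_module Mp p K G V"
    using assms by (simp_all add: irreducible_admissible_def)
  show "complex_space V" by (rule harish_chandra_moduleD(1)[OF hc])
  show "carrier V \<noteq> {\<zero>\<^bsub>V\<^esub>}"
    by (rule irr[unfolded irreducible_hc_module_def, THEN conjunct1])
  show "X \<in> complexified_lie G \<Longrightarrow> linear_map V V (lie_act V X)"
    by (rule harish_chandra_moduleD(2)[OF hc])
qed

text \<open>
  The correspondence, reduced to its algebraic content: a linear surjection of \<open>\<omega>\<close> onto the tensor
  product that is equivariant for both Lie algebras.  Equivariance is recorded on pure tensors only,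
  where \<open>f \<otimes> g\<close> is given by its factors.
\<close>

lemma howe_correspondence_quotient_map:
  fixes \<omega> :: "('o, 'w::euclidean_space cplx \<Rightarrow> 'w cplx, 'm::topological_space) hc_module"
    and \<rho> :: "('v, 'w cplx \<Rightarrow> 'w cplx, 'm) hc_module" and \<rho>' :: "('u, 'w cplx \<Rightarrow> 'w cplx, 'm) hc_module"
  assumes howe: "howe_correspondence Mp p K G G' \<omega> \<rho> \<rho>'"
    and \<omega>: "complex_space \<omega>" and \<rho>: "complex_space \<rho>" and \<rho>': "complex_space \<rho>'"
    and lie_\<omega>: "\<And>X. X \<in> complexified_lie G \<union> complexified_lie G' \<Longrightarrow> linear_map \<omega> \<omega> (lie_act \<omega> X)"
    and lie_\<rho>: "\<And>X. X \<in> complexified_lie G \<Longrightarrow> linear_map \<rho> \<rho> (lie_act \<rho> X)"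
    and lie_\<rho>': "\<And>X. X \<in> complexified_lie G' \<Longrightarrow> linear_map \<rho>' \<rho>' (lie_act \<rho>' X)"
  obtains q where "linear_map \<omega> (tensor \<rho> \<rho>') q" "carrier (tensor \<rho> \<rho>') \<subseteq> q ` carrier \<omega>"
    "\<And>X y v u. X \<in> complexified_lie G \<Longrightarrow> y \<in> carrier \<omega> \<Longrightarrow> v \<in> carrier \<rho> \<Longrightarrow> u \<in> carrier \<rho>' \<Longrightarrow>
      q y = pure_tensor \<rho> \<rho>' v u \<Longrightarrow> q (lie_act \<omega> X y) = pure_tensor \<rho> \<rho>' (lie_act \<rho> X v) u"
    "\<And>X y v u. X \<in> complexified_lie G' \<Longrightarrow> y \<in> carrier \<omega> \<Longrightarrow> v \<in> carrier \<rho> \<Longrightarrow> u \<in> carrier \<rho>' \<Longrightarrow>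
      q y = pure_tensor \<rho> \<rho>' v u \<Longrightarrow> q (lie_act \<omega> X y) = pure_tensor \<rho> \<rho>' v (lie_act \<rho>' X u)"
proof -
  let ?g = "complexified_lie G" and ?g' = "complexified_lie G'"
  obtain N \<Phi> where N: "complex_subspace N \<omega>" "\<forall>X\<in>?g \<union> ?g'. lie_act \<omega> X ` N \<subseteq> N"
    and \<Phi>: "linear_map (quot_space \<omega> N) (tensor \<rho> \<rho>') \<Phi>"
      "bij_betw \<Phi> (carrier (quot_space \<omega> N)) (carrier (tensor \<rho> \<rho>'))"
    and equiv: "\<forall>x\<in>carrier (quot_space \<omega> N).
        (\<forall>X\<in>?g. \<Phi> (quot_map \<omega> N (lie_act \<omega> X) x) = tensor_map \<rho> \<rho>' (lie_act \<rho> X) id (\<Phi> x)) \<and>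
        (\<forall>Y\<in>?g'. \<Phi> (quot_map \<omega> N (lie_act \<omega> Y) x) = tensor_map \<rho> \<rho>' id (lie_act \<rho>' Y) (\<Phi> x))"
    using howe unfolding howe_correspondence_def Let_def
    apply (elim exE conjE)
    subgoal premises prems for N \<Phi>
      by (rule prems(1)[OF prems(2,3,5,6)]) (use prems(7) in \<open>simp add: ball_conj_distrib\<close>)
    done
  define q where "q y = \<Phi> (N +>\<^bsub>\<omega>\<^esub> y)" for y
  have coset: "N +>\<^bsub>\<omega>\<^esub> y \<in> carrier (quot_space \<omega> N)" if "y \<in> carrier \<omega>" for y
    using that by (simp add: carrier_quot_space)
  have q_lie: "q (lie_act \<omega> X y) = \<Phi> (quot_map \<omega> N (lie_act \<omega> X) (N +>\<^bsub>\<omega>\<^esub> y))"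
    if X: "X \<in> ?g \<union> ?g'" and y: "y \<in> carrier \<omega>" for X y
  proof -
    have "quot_map \<omega> N (lie_act \<omega> X) (N +>\<^bsub>\<omega>\<^esub> y) = N +>\<^bsub>\<omega>\<^esub> lie_act \<omega> X y"
      using linear_mapD(1,2)[OF lie_\<omega>[OF X]] N(2) X y by (intro quot_map_coset[OF \<omega> N(1)]) auto
    then show ?thesis by (simp add: q_def)
  qed
  have id: "linear_map V V id" for V :: "(complex, 'x, 'y) module_scheme"
    by (auto simp: linear_map_def)
  show thesis
  proof (rule that)
    show "linear_map \<omega> (tensor \<rho> \<rho>') q"
      using linear_mapD[OF \<Phi>(1)] linear_mapD[OF linear_map_coset[OF \<omega> N(1)]]
      unfolding linear_map_def q_def by simp
    show "carrier (tensor \<rho> \<rho>') \<subseteq> q ` carrier \<omega>"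
      using \<Phi>(2) by (auto simp: bij_betw_def carrier_quot_space q_def)
  next
    fix X y v u
    assume y: "y \<in> carrier \<omega>" and v: "v \<in> carrier \<rho>" "u \<in> carrier \<rho>'"
      and eq: "q y = pure_tensor \<rho> \<rho>' v u"
    have \<Phi>y: "\<Phi> (N +>\<^bsub>\<omega>\<^esub> y) = pure_tensor \<rho> \<rho>' v u" using eq by (simp add: q_def)
    show "q (lie_act \<omega> X y) = pure_tensor \<rho> \<rho>' (lie_act \<rho> X v) u" if X: "X \<in> ?g"
      using q_lie[OF UnI1[OF X] y] bspec[OF equiv coset[OF y], THEN conjunct1, THEN bspec[OF _ X]]
        tensor_map_pure[OF \<rho> \<rho>' lie_\<rho>[OF X] id v] by (simp add: \<Phi>y)
    show "q (lie_act \<omega> X y) = pure_tensor \<rho> \<rho>' v (lie_act \<rho>' X u)" if X: "X \<in> ?g'"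
      using q_lie[OF UnI2[OF X] y] bspec[OF equiv coset[OF y], THEN conjunct2, THEN bspec[OF _ X]]
        tensor_map_pure[OF \<rho> \<rho>' id lie_\<rho>'[OF X] v] by (simp add: \<Phi>y)
  qed
qed

theorem theorem1p3:
  fixes s :: "'w::euclidean_space \<Rightarrow> 'w \<Rightarrow> real"
    and Mp :: "'m::topological_space monoid"
    and p :: "'m \<Rightarrow> 'w \<Rightarrow>\<^sub>L 'w"
    and G\<^sub>0 G\<^sub>0' K :: "('w \<Rightarrow>\<^sub>L 'w) set"
    and \<omega> :: "(('w cplx word \<Rightarrow>\<^sub>0 complex) set set, 'w cplx \<Rightarrow> 'w cplx, 'm) hc_module"
    and \<rho> :: "('v, 'w cplx \<Rightarrow> 'w cplx, 'm) hc_module"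
    and \<rho>' :: "('u, 'w cplx \<Rightarrow> 'w cplx, 'm) hc_module"
  defines "\<gg> \<equiv> complexified_lie G\<^sub>0" and "\<gg>' \<equiv> complexified_lie G\<^sub>0'"
  assumes "symplectic_form s"
    and "irreducible_reductive_dual_pair s G\<^sub>0 G\<^sub>0'"
    and "metaplectic_cover s Mp p"
    and "maximal_compact_subgroup s K"
    and "induces_cartan_decomposition s K G\<^sub>0"
    and "induces_cartan_decomposition s K G\<^sub>0'"
    and "oscillator_module s Mp p K \<omega>"
    and "irreducible_admissible Mp p K G\<^sub>0 \<rho>"
    and "irreducible_admissible Mp p K G\<^sub>0' \<rho>'"
    and "howe_correspondence Mp p K G\<^sub>0 G\<^sub>0' \<omega> \<rho> \<rho>'"
    and "canonical_hom s \<gg>' L" and "canonical_hom s \<gg> R"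
  shows "transfer s \<gg> L R (annihilator \<gg>' \<rho>') \<subseteq> annihilator \<gg> \<rho>"
proof -
  have weyl_rel: "weyl_relations s \<subseteq> carrier (free_algebra UNIV)"
    by (auto simp: free_algebra_def)
  have weyl_ring: "ring (weyl s)" and weyl_space: "complex_space (weyl s)"
    unfolding weyl_def by (rule ring_presented[OF weyl_rel] complex_space_presented[OF weyl_rel])+
  have weyl_assoc: "(c \<odot>\<^bsub>weyl s\<^esub> a) \<otimes>\<^bsub>weyl s\<^esub> b = c \<odot>\<^bsub>weyl s\<^esub> (a \<otimes>\<^bsub>weyl s\<^esub> b)"
    if "a \<in> carrier (weyl s)" "b \<in> carrier (weyl s)" for a b c
    using presented_smult_assoc[OF weyl_rel] that unfolding weyl_def by blast
  have weyl_gen: "weyl_gen s v \<in> carrier (weyl s)" for v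
    by (simp add: weyl_def weyl_gen_def presented_class(1)[OF weyl_rel] presented_gen_eq free_algebra_def)

  obtain J a where \<omega>: "\<omega> = module.extend (fock_space s J)
        (hc_module.fields (\<lambda>X. weyl_act s J (sp_to_weyl s X)) a)"
      and hc_\<omega>: "harish_chandra_module Mp p K (carrier (Sp s)) \<omega>"
    using assms(9) by (auto simp: oscillator_module_def)
  have \<omega>_simps: "carrier \<omega> = carrier (fock_space s J)" "add \<omega> = add (fock_space s J)"
      "Module.smult \<omega> = Module.smult (fock_space s J)"
      "lie_act \<omega> X = weyl_act s J (sp_to_weyl s X)" for X
    by (simp_all add: \<omega> module.defs hc_module.defs)
  have \<omega>_space: "complex_space \<omega>" by (rule harish_chandra_moduleD(1)[OF hc_\<omega>])
  have annihilators: "weyl_gen s ` {v. cplx_endo J 0 v = cplx_scale \<i> v} \<subseteq> carrier (weyl s)"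
    using weyl_gen by auto
  note fock_ideal = generated_left_ideal[OF weyl_ring weyl_space annihilators weyl_assoc,
      folded fock_ideal_def]
  note fock_action = quotient_action[OF weyl_ring weyl_space fock_ideal(1) weyl_assoc fock_ideal(2)]
  have weyl_act: "weyl_act s J = (\<lambda>a. quot_map (weyl s) (fock_ideal s J) (\<lambda>x. a \<otimes>\<^bsub>weyl s\<^esub> x))"
    by (rule ext) (rule weyl_act_def)
  have fock: "algebra_action (weyl s) (fock_space s J) (weyl_act s J)"
    unfolding fock_space_def weyl_act by (rule fock_action)
  have act: "algebra_action (weyl s) \<omega> (weyl_act s J)"
    by (rule algebra_action_cong[OF fock \<omega>_space \<omega>_simps(1-3)])
  interpret act: algebra_action "weyl s" \<omega> "weyl_act s J" by (rule act)

  have subgroups: "G\<^sub>0 \<subseteq> carrier (Sp s)" "G\<^sub>0' \<subseteq> carrier (Sp s)"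
    using assms(4) subgroup.subset
    unfolding irreducible_reductive_dual_pair_def reductive_dual_pair_def by blast+
  have sp: "\<gg> \<subseteq> complexified_lie (carrier (Sp s))" "\<gg>' \<subseteq> complexified_lie (carrier (Sp s))"
    using subgroups unfolding \<gg>_def \<gg>'_def complexified_lie_def real_lie_def by blast+
  have lie_\<omega>: "linear_map \<omega> \<omega> (lie_act \<omega> X)" if "X \<in> \<gg> \<union> \<gg>'" for X
    using harish_chandra_moduleD(2)[OF hc_\<omega>] sp that by blast

  note \<rho> = irreducible_admissibleD[OF assms(10), folded \<gg>_def]
  note \<rho>' = irreducible_admissibleD[OF assms(11), folded \<gg>'_def]

  obtain q where q: "linear_map \<omega> (tensor \<rho> \<rho>') q" and q_surj: "carrier (tensor \<rho> \<rho>') \<subseteq> q ` carrier \<omega>"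
    and g_pure: "\<And>X y v u. X \<in> \<gg> \<Longrightarrow> y \<in> carrier \<omega> \<Longrightarrow> v \<in> carrier \<rho> \<Longrightarrow> u \<in> carrier \<rho>' \<Longrightarrow>
      q y = pure_tensor \<rho> \<rho>' v u \<Longrightarrow> q (lie_act \<omega> X y) = pure_tensor \<rho> \<rho>' (lie_act \<rho> X v) u"
    and g'_pure: "\<And>X y v u. X \<in> \<gg>' \<Longrightarrow> y \<in> carrier \<omega> \<Longrightarrow> v \<in> carrier \<rho> \<Longrightarrow> u \<in> carrier \<rho>' \<Longrightarrow>
      q y = pure_tensor \<rho> \<rho>' v u \<Longrightarrow> q (lie_act \<omega> X y) = pure_tensor \<rho> \<rho>' v (lie_act \<rho>' X u)"
    using howe_correspondence_quotient_map[OF assms(12) \<omega>_space \<rho>(1) \<rho>'(1), folded \<gg>_def \<gg>'_def,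
        OF lie_\<omega> \<rho>(3) \<rho>'(3)] by blast

  \<comment> \<open>\<open>\<omega>\<close> is not zero, as it maps onto the tensor product of two nonzero spaces.\<close>
  have weyl_nz: "\<one>\<^bsub>weyl s\<^esub> \<noteq> \<zero>\<^bsub>weyl s\<^esub>"
  proof -
    interpret \<rho>: Module.module complex_field \<rho> by (rule \<rho>(1))
    interpret \<rho>': Module.module complex_field \<rho>' by (rule \<rho>'(1))
    obtain v where v: "v \<in> carrier \<rho>" "v \<noteq> \<zero>\<^bsub>\<rho>\<^esub>" using \<rho>(2) \<rho>.zero_closed by blast
    obtain u where u: "u \<in> carrier \<rho>'" "u \<noteq> \<zero>\<^bsub>\<rho>'\<^esub>" using \<rho>'(2) \<rho>'.zero_closed by blast
    have "pure_tensor \<rho> \<rho>' v u \<in> q ` carrier \<omega>"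
      by (rule subsetD[OF q_surj linear_mapD(1)[OF pure_tensor_linear(2)[OF \<rho>(1) \<rho>'(1) v(1)] u(1)]])
    then obtain y where y: "y \<in> carrier \<omega>" "pure_tensor \<rho> \<rho>' v u = q y" by (elim imageE)
    have "y \<noteq> \<zero>\<^bsub>\<omega>\<^esub>"
      using pure_tensor_eq_zeroD[OF \<rho>(1) \<rho>'(1) v(1) u(1) _ u(2)] v(2) y(2)
        linear_map_zero[OF \<omega>_space complex_space_tensor[OF \<rho>(1) \<rho>'(1)] q] by auto
    then show ?thesis by (rule act.one_not_zero[OF y(1)])
  qed

  have R: "R \<in> ring_hom (presented \<gg> (enveloping_relations (endo_lie \<gg>))) (weyl s)"
      "linear_map (presented \<gg> (enveloping_relations (endo_lie \<gg>))) (weyl s) R"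
      "\<And>X. X \<in> \<gg> \<Longrightarrow> R (presented_gen \<gg> (enveloping_relations (endo_lie \<gg>)) X) = sp_to_weyl s X"
    using assms(14) by (auto simp: canonical_hom_def enveloping_def enveloping_gen_def)
  have L: "L \<in> ring_hom (presented \<gg>' (enveloping_relations (endo_lie \<gg>'))) (weyl s)"
      "linear_map (presented \<gg>' (enveloping_relations (endo_lie \<gg>'))) (weyl s) L"
      "\<And>X. X \<in> \<gg>' \<Longrightarrow> L (presented_gen \<gg>' (enveloping_relations (endo_lie \<gg>')) X) = sp_to_weyl s X"
    using assms(13) by (auto simp: canonical_hom_def enveloping_def enveloping_gen_def)
  note rel = relations_closed_of_hom[OF weyl_space weyl_nz]
  have main: "free_act \<rho> (lie_act \<rho>) t v = \<zero>\<^bsub>\<rho>\<^esub>"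
    if "a \<in> transfer s \<gg> L R (annihilator \<gg>' \<rho>')" "t \<in> a" "v \<in> carrier \<rho>" for a t v
  proof (rule act.right_ideal_annihilates[OF \<rho>(1) \<rho>'(1) rel[OF R(1,2)] rel[OF L(1,2)] R(1,2) L(1,2)
        \<rho>(3) \<rho>'(3) q q_surj _ _ _ \<rho>'(2) _ _ that(2,3)])
    show "a \<in> carrier (presented \<gg> (enveloping_relations (endo_lie \<gg>)))"
      and "R a \<in> generated_right_ideal (weyl s) (L ` annihilator \<gg>' \<rho>')"
      using that by (auto simp: transfer_def enveloping_def)
  next
    fix X y v u
    assume *: "X \<in> \<gg>" "y \<in> carrier \<omega>" "v \<in> carrier \<rho>" "u \<in> carrier \<rho>'" "q y = pure_tensor \<rho> \<rho>' v u"
    show "q (weyl_act s J (R (presented_gen \<gg> (enveloping_relations (endo_lie \<gg>)) X)) y) =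
        pure_tensor \<rho> \<rho>' (lie_act \<rho> X v) u"
      unfolding R(3)[OF *(1)] \<omega>_simps(4)[symmetric] by (rule g_pure[OF *])
  next
    fix X y v u
    assume *: "X \<in> \<gg>'" "y \<in> carrier \<omega>" "v \<in> carrier \<rho>" "u \<in> carrier \<rho>'" "q y = pure_tensor \<rho> \<rho>' v u"
    show "q (weyl_act s J (L (presented_gen \<gg>' (enveloping_relations (endo_lie \<gg>')) X)) y) =
        pure_tensor \<rho> \<rho>' v (lie_act \<rho>' X u)"
      unfolding L(3)[OF *(1)] \<omega>_simps(4)[symmetric] by (rule g'_pure[OF *])
  next
    fix b assume "b \<in> annihilator \<gg>' \<rho>'"
    then show "b \<in> carrier (presented \<gg>' (enveloping_relations (endo_lie \<gg>'))) \<and>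
        (\<forall>t\<in>b. \<forall>u\<in>carrier \<rho>'. free_act \<rho>' (lie_act \<rho>') t u = \<zero>\<^bsub>\<rho>'\<^esub>)"
      by (simp add: annihilator_def enveloping_def)
  qed
  show ?thesis
    using main unfolding annihilator_def[of \<gg> \<rho>] by (auto simp: transfer_def)
qed

end
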